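(* For any positive integers $t,s$ with $ts=n$, there is an $[nt,s]$-scheme for \textsc{MaxMatching} on $n$-vertex graphs. This is optimal up to logarithmic factors, since any $(h,v)$-scheme for \textsc{MaxMatching} requires $hv=\Omega(n^2)$.
   Context: Annotated streaming model (schemes): a space-bounded Verifier reads an input stream $\sigma$; after the stream ends, an all-powerful Prover sends a help message to the Verifier as a stream. A scheme for a function $f$ consists of the Verifier's randomized streaming algorithm, the honest Prover's help function, and the Verifier's output procedure, outputting a value in $\mathrm{range}(f)\cup\{\bot\}$ ($\bot$ = reject), with perfect completeness (honest help makes the Verifier output $f(\sigma)$ with probability 1) and soundness error at most $1/3$ (for every $\sigma$ and every help message, the probability of outputting a value outside $\{f(\sigma),\bot\}$ is at most $1/3$). An $(h,v)$-scheme uses $O(h)$ bits of help and $O(v)$ bits of space; an $[h,v]$-scheme uses $\tilde{O}(h)$ bits of help and $\tilde{O}(v)$ bits of space, where $\tilde{O}$ hides factors polynomial in $\log n$. \textsc{MaxMatching}: the input is a graph $G$ on vertex set $[n]$ given as a stream of its edges; the desired output is $\alpha'(G)$, the cardinality of a maximum matching of $G$. *)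

theory Defs
  imports Complex_Main
begin

(* Graphs on vertex set {0..<n}; an edge {u,v} is the token (u,v) with u < v.
   A valid input stream lists each edge of the graph exactly once. *)
definition valid_stream :: "nat \<Rightarrow> (nat \<times> nat) list \<Rightarrow> bool" where
  "valid_stream n \<sigma> \<longleftrightarrow> distinct \<sigma> \<and> (\<forall>(u, v) \<in> set \<sigma>. u < v \<and> v < n)"

definition is_matching :: "(nat \<times> nat) set \<Rightarrow> (nat \<times> nat) set \<Rightarrow> bool" where
  "is_matching E M \<longleftrightarrow> M \<subseteq> E \<and>
     (\<forall>e\<in>M. \<forall>e'\<in>M. e \<noteq> e' \<longrightarrow> {fst e, snd e} \<inter> {fst e', snd e'} = {})"

definition max_matching_size :: "(nat \<times> nat) list \<Rightarrow> nat" where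
  "max_matching_size \<sigma> = Max (card ` {M. is_matching (set \<sigma>) M})"

(* A scheme: the Verifier has a random string of rbits bits (not seen by the Prover),
   a memory state (a natural number), an initial state, a transition per stream token,
   a transition per help bit, and an output (None = reject).  The honest Prover maps
   the input stream to a help message (a bit string). *)
record scheme =
  rbits :: nat
  vinit :: "bool list \<Rightarrow> nat"
  vstep :: "bool list \<Rightarrow> nat \<Rightarrow> nat \<times> nat \<Rightarrow> nat"
  vhelp :: "bool list \<Rightarrow> nat \<Rightarrow> bool \<Rightarrow> nat"
  vout  :: "bool list \<Rightarrow> nat \<Rightarrow> nat option"
  prover :: "(nat \<times> nat) list \<Rightarrow> bool list"

definition run_scheme :: "scheme \<Rightarrow> bool list \<Rightarrow> (nat \<times> nat) list \<Rightarrow> bool list \<Rightarrow> nat option" where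
  "run_scheme P \<rho> \<sigma> w =
     vout P \<rho> (foldl (vhelp P \<rho>) (foldl (vstep P \<rho>) (vinit P \<rho>) \<sigma>) w)"

definition space_bounded :: "scheme \<Rightarrow> nat \<Rightarrow> bool" where
  "space_bounded P S \<longleftrightarrow>
     (\<forall>\<rho> x e b. vinit P \<rho> < 2 ^ S \<and> vstep P \<rho> x e < 2 ^ S \<and> vhelp P \<rho> x b < 2 ^ S)"

definition help_bounded :: "scheme \<Rightarrow> nat \<Rightarrow> nat \<Rightarrow> bool" where
  "help_bounded P n H \<longleftrightarrow> (\<forall>\<sigma>. valid_stream n \<sigma> \<longrightarrow> length (prover P \<sigma>) \<le> H)"

definition is_scheme_for :: "((nat \<times> nat) list \<Rightarrow> nat) \<Rightarrow> nat \<Rightarrow> scheme \<Rightarrow> bool" where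
  "is_scheme_for f n P \<longleftrightarrow>
     (\<forall>\<sigma> \<rho>. valid_stream n \<sigma> \<and> length \<rho> = rbits P \<longrightarrow>
         run_scheme P \<rho> \<sigma> (prover P \<sigma>) = Some (f \<sigma>)) \<and>
     (\<forall>\<sigma> w. valid_stream n \<sigma> \<longrightarrow>
         3 * card {\<rho>. length \<rho> = rbits P \<and> run_scheme P \<rho> \<sigma> w \<notin> {Some (f \<sigma>), None}}
           \<le> 2 ^ rbits P)"

end

theory Submission
  imports Defs "HOL-Library.FuncSet"
    "HOL-Computational_Algebra.Primes" "HOL-Computational_Algebra.Polynomial"
begin

text \<open>
  Upper bound. By the Tutte--Berge formula, optimality of a matching is witnessed by vertex labels:
  a barrier \<open>U\<close>, a class for every other vertex, no edge joining different classes, and a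
  matching of size \<open>|U| + (\<Sum>C. \<lfloor>|C| / 2\<rfloor>)\<close>. All conditions on the labels are local to pairs of
  vertices, except for one bilinear identity: the sum over the edges \<open>(u, v)\<close> of a weight
  \<open>W u (l u) v (l v)\<close> has to equal a sum over the vertices. Cut the vertices into \<open>t\<close> chunks of size
  \<open>s\<close>. The Prover sends, for every pair of chunks, a copy of the labels of both; equality of the
  copies is tested by a polynomial fingerprint modulo a prime \<open>p\<close>. For \<open>j < s\<close> the Verifier keeps
  \<open>A\<^sub>j(r) = (\<Sum>(u, v). r^(u t + v div s))\<close>, the sum being over the edges with \<open>v mod s = j\<close>, and a reversed
  polynomial \<open>Z\<^sub>j(r)\<close> with the weights as coefficients, such that the coefficient of
  \<open>\<Sum>j<s. A\<^sub>j Z\<^sub>j\<close> at \<open>n t\<close> is the bilinear sum. The Prover supplies the \<open>2 n t\<close> coefficients of this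
  polynomial, and the Verifier compares it with \<open>\<Sum>j<s. A\<^sub>j(r) Z\<^sub>j(r)\<close>.

  Lower bound. A bipartite graph on \<open>m + m\<close> vertices stores \<open>m\<^sup>2\<close> bits; pendant edges at all vertices
  but \<open>a\<^sub>i\<close> and \<open>b\<^sub>j\<close> reveal whether \<open>(a\<^sub>i, b\<^sub>j)\<close> is an edge. Running \<open>O(H)\<close> copies of a scheme against
  the same help message makes a union bound over all help messages possible, so that \<open>O(H S)\<close> bits of
  memory solve the index problem for \<open>m\<^sup>2\<close> bits.
\<close>

section \<open>The Tutte--Berge formula\<close>

abbreviation ends :: "nat \<times> nat \<Rightarrow> nat set" where
  "ends e \<equiv> {fst e, snd e}"

definition covered :: "(nat \<times> nat) set \<Rightarrow> nat set" where
  "covered M = (\<Union>e\<in>M. ends e)"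

definition matching_number :: "(nat \<times> nat) set \<Rightarrow> nat" where
  "matching_number E = Max (card ` {M. is_matching E M})"

definition is_max_matching :: "(nat \<times> nat) set \<Rightarrow> (nat \<times> nat) set \<Rightarrow> bool" where
  "is_max_matching E M \<longleftrightarrow> is_matching E M \<and> card M = matching_number E"

definition simple_on :: "nat \<Rightarrow> (nat \<times> nat) set \<Rightarrow> bool" where
  "simple_on n E \<longleftrightarrow> (\<forall>(u, v)\<in>E. u < v \<and> v < n)"

definition avoiding :: "nat set \<Rightarrow> (nat \<times> nat) set \<Rightarrow> (nat \<times> nat) set" where
  "avoiding U E = {e \<in> E. ends e \<inter> U = {}}"

lemma simple_onD: "simple_on n E \<Longrightarrow> e \<in> E \<Longrightarrow> fst e < snd e \<and> snd e < n"
  by (auto simp: simple_on_def)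

lemma simple_on_finite: "simple_on n E \<Longrightarrow> finite E"
  by (rule finite_subset[of _ "{..<n} \<times> {..<n}"]) (auto simp: simple_on_def)

lemma simple_on_mono: "simple_on n E \<Longrightarrow> F \<subseteq> E \<Longrightarrow> simple_on n F"
  by (auto simp: simple_on_def)

lemma avoiding_subset: "avoiding U E \<subseteq> E"
  by (auto simp: avoiding_def)

lemma is_matching_subset: "is_matching E M \<Longrightarrow> M' \<subseteq> M \<Longrightarrow> M' \<subseteq> F \<Longrightarrow> is_matching F M'"
  unfolding is_matching_def by blast

lemma matching_unique:
  "is_matching E M \<Longrightarrow> e \<in> M \<Longrightarrow> f \<in> M \<Longrightarrow> x \<in> ends e \<Longrightarrow> x \<in> ends f \<Longrightarrow> e = f"
  unfolding is_matching_def by blast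

lemma is_matching_insert:
  assumes "is_matching E M" "e \<in> E" "ends e \<inter> covered M = {}"
  shows "is_matching E (insert e M)"
  using assms unfolding is_matching_def covered_def by blast

lemma finite_matchings: "finite E \<Longrightarrow> finite {M. is_matching E M}"
  by (rule finite_subset[of _ "Pow E"]) (auto simp: is_matching_def)

lemma matching_finite: "finite E \<Longrightarrow> is_matching E M \<Longrightarrow> finite M"
  by (auto simp: is_matching_def intro: finite_subset)

lemma card_matching_le:
  "finite E \<Longrightarrow> is_matching E M \<Longrightarrow> card M \<le> matching_number E"
  unfolding matching_number_def by (intro Max_ge) (auto simp: finite_matchings)

lemma max_matching_exists:
  assumes "finite E" obtains M where "is_max_matching E M"
proof -
  have "is_matching E {}" by (simp add: is_matching_def)
  then have "matching_number E \<in> card ` {M. is_matching E M}"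
    unfolding matching_number_def using assms by (intro Max_in) (auto simp: finite_matchings)
  then show ?thesis using that by (auto simp: is_max_matching_def)
qed

lemma card_covered:
  assumes "simple_on n E" "is_matching E M"
  shows "card (covered M) = 2 * card M"
proof -
  have fin: "finite M" using assms simple_on_finite matching_finite by blast
  have "card (covered M) = (\<Sum>e\<in>M. card (ends e))" unfolding covered_def
    using fin assms(2) by (intro card_UN_disjoint) (auto simp: is_matching_def)
  also have "\<dots> = (\<Sum>e\<in>M. 2)"
  proof (rule sum.cong)
    fix e assume "e \<in> M"
    then have "fst e < snd e" using assms simple_onD by (auto simp: is_matching_def)
    then show "card (ends e) = 2" by simp
  qed simp
  finally show ?thesis by simp
qed

section \<open>Gallai's lemma on jointly essential vertices\<close>

lemma finite_maximizer:
  fixes f :: "'a \<Rightarrow> nat"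
  assumes "finite A" "A \<noteq> {}"
  obtains x where "x \<in> A" "\<And>y. y \<in> A \<Longrightarrow> f y \<le> f x"
proof -
  have "Max (f ` A) \<in> f ` A" using assms by (intro Max_in) auto
  then obtain x where "x \<in> A" "f x = Max (f ` A)" by auto
  then show ?thesis using assms by (intro that[of x]) auto
qed

text \<open>Distinct vertices are related when no maximum matching misses both. In a graph where
  every vertex is missed by some maximum matching, this is an equivalence relation whose classes are
  the connected components, all of them factor-critical. The case \<open>u = v\<close> gives
  reflexivity.\<close>

definition jointly_essential :: "(nat \<times> nat) set \<Rightarrow> nat \<Rightarrow> nat \<Rightarrow> bool" where
  "jointly_essential E u v \<longleftrightarrow>
     u = v \<or> (\<forall>M. is_max_matching E M \<longrightarrow> u \<in> covered M \<or> v \<in> covered M)"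

lemma jointly_essential_refl: "jointly_essential E u u"
  by (simp add: jointly_essential_def)

lemma jointly_essential_sym: "jointly_essential E u v \<Longrightarrow> jointly_essential E v u"
  by (auto simp: jointly_essential_def)

lemma jointly_essential_edge:
  assumes "finite E" "(u, v) \<in> E"
  shows "jointly_essential E u v"
  unfolding jointly_essential_def
proof (rule disjI2, intro allI impI, rule ccontr)
  fix M assume M: "is_max_matching E M" and "\<not> (u \<in> covered M \<or> v \<in> covered M)"
  then have "is_matching E (insert (u, v) M)"
    using assms by (intro is_matching_insert) (auto simp: is_max_matching_def)
  moreover have "(u, v) \<notin> M" using \<open>\<not> _\<close> by (force simp: covered_def)
  moreover have "finite M" using M assms matching_finite by (auto simp: is_max_matching_def)
  ultimately show False
    using card_matching_le[OF assms(1), of "insert (u, v) M"] M by (simp add: is_max_matching_def)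
qed

text \<open>Gallai's lemma. If a maximum matching \<open>M\<close> missed both \<open>u\<close> and \<open>v\<close>, take a maximum matching
  \<open>N\<close> missing \<open>t\<close> with \<open>M \<inter> N\<close> as large as possible; exchanging one edge of \<open>N\<close> for one of \<open>M\<close>
  enlarges the intersection.\<close>

lemma jointly_essential_trans:
  assumes E: "simple_on n E"
    and avoid: "\<exists>N. is_max_matching E N \<and> t \<notin> covered N"
    and ut: "jointly_essential E u t" and tv: "jointly_essential E t v"
  shows "jointly_essential E u v"
proof (rule ccontr)
  assume "\<not> ?thesis"
  then obtain M where uv: "u \<noteq> v" and M: "is_max_matching E M" and Mu: "u \<notin> covered M" and Mv: "v \<notin> covered M"
    by (auto simp: jointly_essential_def)
  have finE: "finite E" using E by (rule simple_on_finite)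
  have ne: "u \<noteq> t" "t \<noteq> v" using ut tv \<open>\<not> jointly_essential E u v\<close> by auto
  define \<N> where "\<N> = {N. is_max_matching E N \<and> t \<notin> covered N}"
  have "finite \<N>" using finite_matchings[OF finE]
    by (rule rev_finite_subset) (auto simp: \<N>_def is_max_matching_def)
  moreover have "\<N> \<noteq> {}" using avoid by (auto simp: \<N>_def)
  ultimately obtain N where N: "N \<in> \<N>"
    and Nmax: "\<And>N'. N' \<in> \<N> \<Longrightarrow> card (M \<inter> N') \<le> card (M \<inter> N)"
    by (rule finite_maximizer[of \<N> "\<lambda>N. card (M \<inter> N)"]) (rule that)
  have mM: "is_matching E M" and mN: "is_matching E N" and cMN: "card M = card N"
    and Nt: "t \<notin> covered N" and Nm: "is_max_matching E N"
    using M N by (auto simp: \<N>_def is_max_matching_def)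
  have finM: "finite M" and finN: "finite N" using mM mN finE matching_finite by auto
  have Nuv: "u \<in> covered N" "v \<in> covered N"
    using ut tv ne Nt Nm by (auto simp: jointly_essential_def)
  have finc: "finite (covered M)" "finite (covered N)" using finM finN by (auto simp: covered_def)
  have "card (covered M) = card (covered N)" using card_covered[OF E] mM mN cMN by simp
  \<comment> \<open>Both matchings cover equally many vertices, and \<open>N\<close> covers
    \<open>u\<close> and \<open>v\<close>, which \<open>M\<close> misses. So \<open>M\<close> covers
    at least two vertices that \<open>N\<close> misses, one of them different from
    \<open>t\<close>.\<close>
  then have "card (covered M - covered N) = card (covered N - covered M)"
    using finc by (metis Int_commute card_Diff_subset_Int finite_Int)
  moreover have "card {u, v} \<le> card (covered N - covered M)"
    using finc Nuv Mu Mv by (intro card_mono) auto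
  ultimately have "card (covered M - covered N) \<ge> 2" using uv by simp
  then have "\<not> covered M - covered N \<subseteq> {t}"
    using card_mono[of "{t}" "covered M - covered N"] by auto
  then obtain x where x: "x \<in> covered M" "x \<notin> covered N" "x \<noteq> t" by auto
  then obtain e where e: "e \<in> M" "x \<in> ends e" by (auto simp: covered_def)
  have eE: "e \<in> E" using e mM by (auto simp: is_matching_def)
  have eN: "e \<notin> N" using x e by (auto simp: covered_def)
  obtain y where y: "ends e = {x, y}" using e by auto
  have "y \<in> covered N"
  proof (rule ccontr)
    assume "y \<notin> covered N"
    then have "is_matching E (insert e N)" using mN eE x y by (intro is_matching_insert) auto
    then have "card (insert e N) \<le> matching_number E" using finE card_matching_le by blast
    then show False using eN finN Nm by (simp add: is_max_matching_def)
  qed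
  then obtain f where f: "f \<in> N" "y \<in> ends f" by (auto simp: covered_def)
  have fM: "f \<notin> M" using matching_unique[OF mM, of e f y] e f y eN by auto
  define N' where "N' = insert e (N - {f})"
  have "is_matching E N'" unfolding N'_def
  proof (rule is_matching_insert)
    show "is_matching E (N - {f})" using mN by (auto simp: is_matching_def)
    have "y \<notin> covered (N - {f})" using matching_unique[OF mN _ f(1) _ f(2)] by (auto simp: covered_def)
    moreover have "x \<notin> covered (N - {f})" using x by (auto simp: covered_def)
    ultimately show "ends e \<inter> covered (N - {f}) = {}" using y by auto
  qed (rule eE)
  moreover have "card N' = card N" using eN f finN card_Suc_Diff1[OF finN f(1)] by (simp add: N'_def)
  moreover have "t \<notin> covered N'" using Nt x y \<open>y \<in> covered N\<close> unfolding N'_def covered_def by auto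
  ultimately have "N' \<in> \<N>" using Nm by (auto simp: \<N>_def is_max_matching_def)
  then have "card (M \<inter> N') \<le> card (M \<inter> N)" by (rule Nmax)
  moreover have "M \<inter> N' = insert e (M \<inter> N)" using e fM by (auto simp: N'_def)
  ultimately show False using eN finM by simp
qed

text \<open>By the fifth clause \<open>M\<close> misses at most one vertex of each class, and by the
  fourth its edges stay inside classes; so \<open>M\<close> has floor(|C| / 2) edges in a class C,
  and the matching number attains the Tutte--Berge bound for \<open>U\<close>. The bound
  \<open>cls v \<le> v\<close> lets a class be sent as a small number.\<close>

definition tutte_berge_certificate ::
  "nat \<Rightarrow> (nat \<times> nat) set \<Rightarrow> nat set \<Rightarrow> (nat \<times> nat) set \<Rightarrow> (nat \<Rightarrow> nat) \<Rightarrow> bool" where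
  "tutte_berge_certificate n E U M cls \<longleftrightarrow>
     U \<subseteq> {..<n} \<and> is_matching (avoiding U E) M \<and> matching_number E = card U + card M \<and>
     (\<forall>(u, v)\<in>avoiding U E. cls u = cls v) \<and>
     (\<forall>u v. u \<noteq> v \<and> cls u = cls v \<longrightarrow> u \<in> covered M \<or> v \<in> covered M) \<and>
     (\<forall>v. cls v \<le> v)"

text \<open>\<open>U\<close> is a largest set whose deletion lowers the matching number by exactly
  |U|; the empty set is one such. By maximality no remaining vertex lies in every maximum matching,
  so Gallai's lemma makes joint essentiality an equivalence relation, and its classes are the
  classes of the certificate.\<close>

theorem tutte_berge:
  assumes E: "simple_on n E"
  shows "\<exists>U M cls. tutte_berge_certificate n E U M cls"
proof -
  define \<U> where "\<U> = {U. U \<subseteq> {..<n} \<and> matching_number E = matching_number (avoiding U E) + card U}"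
  have "{} \<in> \<U>" by (simp add: \<U>_def avoiding_def)
  moreover have "finite \<U>" by (rule finite_subset[of _ "Pow {..<n}"]) (auto simp: \<U>_def)
  ultimately obtain U where U: "U \<in> \<U>" and Umax: "\<And>U'. U' \<in> \<U> \<Longrightarrow> card U' \<le> card U"
    by (metis empty_iff finite_maximizer)
  define F where "F = avoiding U E"
  have F: "simple_on n F" using E avoiding_subset unfolding F_def by (rule simple_on_mono)
  have finF: "finite F" using F by (rule simple_on_finite)
  have finU: "finite U" using U finite_subset by (auto simp: \<U>_def)
  obtain M where M: "is_max_matching F M" using finF by (rule max_matching_exists)
  \<comment> \<open>Deleting a vertex \<open>t\<close> covered by all maximum matchings of
    \<open>F\<close> would lower the matching number by exactly one, so \<open>insert t U\<close>
    would be a larger set of the same kind.\<close>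
  have avoid: "\<exists>N. is_max_matching F N \<and> t \<notin> covered N" for t
  proof (rule ccontr)
    assume "\<not> ?thesis"
    then have all: "t \<in> covered N" if "is_max_matching F N" for N using that by blast
    then have "t \<in> covered M" using M by blast
    then obtain e where e: "e \<in> M" "t \<in> ends e" by (auto simp: covered_def)
    have mM: "is_matching F M" using M by (simp add: is_max_matching_def)
    have finM: "finite M" using mM finF matching_finite by blast
    have eF: "e \<in> F" using e mM by (auto simp: is_matching_def)
    then have tU: "t \<notin> U" and tn: "t < n"
      using e simple_onD[OF F eF] by (auto simp: F_def avoiding_def)
    define F' where "F' = avoiding (insert t U) E"
    have F'F: "F' \<subseteq> F" by (auto simp: F'_def F_def avoiding_def)
    have finF': "finite F'" using F'F finF by (rule finite_subset)
    obtain M' where M': "is_max_matching F' M'" using finF' by (rule max_matching_exists)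
    have mM': "is_matching F M'" using M' F'F by (auto simp: is_max_matching_def is_matching_def)
    have "t \<notin> covered M'" using M'
      by (auto simp: is_max_matching_def is_matching_def covered_def F'_def avoiding_def)
    then have "card M' \<noteq> matching_number F" using all mM' by (auto simp: is_max_matching_def)
    then have "card M' < matching_number F" using card_matching_le[OF finF mM'] by simp
    moreover have "is_matching F' (M - {e})"
    proof (rule is_matching_subset[OF mM])
      show "M - {e} \<subseteq> F'"
      proof
        fix f assume f: "f \<in> M - {e}"
        then have "t \<notin> ends f" using matching_unique[OF mM _ e(1) _ e(2)] by blast
        then show "f \<in> F'" using f mM by (auto simp: F'_def F_def avoiding_def is_matching_def)
      qed
    qed auto
    then have "card (M - {e}) \<le> matching_number F'" by (rule card_matching_le[OF finF'])
    ultimately have "matching_number F = matching_number F' + 1"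
      using M M' e finM by (simp add: is_max_matching_def)
    then have "insert t U \<in> \<U>" using U tU tn finU by (simp add: \<U>_def F_def F'_def)
    then show False using Umax[of "insert t U"] tU finU by simp
  qed
  define rel where "rel = jointly_essential F"
  have rel_trans: "rel u v" if "rel u t" "rel t v" for u t v
    using jointly_essential_trans[OF F avoid] that unfolding rel_def by blast
  have rel_sym: "rel u v" if "rel v u" for u v
    using that jointly_essential_sym unfolding rel_def by blast
  have rel_refl: "rel u u" for u by (simp add: rel_def jointly_essential_refl)
  \<comment> \<open>The least member represents a class, whence
    \<open>cls v \<le> v\<close>.\<close>
  define cls where "cls v = (LEAST w. rel w v)" for v
  have cls1: "rel (cls v) v" for v unfolding cls_def by (rule LeastI[of "\<lambda>w. rel w v" v]) (rule rel_refl)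
  have cls2: "cls u = cls v" if "rel u v" for u v
  proof -
    have "rel w u \<longleftrightarrow> rel w v" for w using that rel_trans rel_sym by blast
    then show ?thesis by (simp add: cls_def)
  qed
  have cls3: "rel u v" if "cls u = cls v" for u v
    using cls1[of u] cls1[of v] that rel_trans rel_sym by metis
  have "U \<subseteq> {..<n}" using U by (simp add: \<U>_def)
  moreover have "is_matching (avoiding U E) M" using M by (simp add: is_max_matching_def F_def)
  moreover have "matching_number E = card U + card M"
    using U M by (simp add: \<U>_def is_max_matching_def F_def)
  moreover have "cls u = cls v" if "(u, v) \<in> avoiding U E" for u v
    using that jointly_essential_edge[OF finF, of u v] by (intro cls2) (simp add: F_def rel_def)
  moreover have "u \<in> covered M \<or> v \<in> covered M" if "u \<noteq> v" "cls u = cls v" for u v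
    using cls3[OF that(2)] that(1) M by (auto simp: rel_def jointly_essential_def)
  moreover have "cls v \<le> v" for v unfolding cls_def by (rule Least_le) (rule rel_refl)
  ultimately have "tutte_berge_certificate n E U M cls" by (auto simp: tutte_berge_certificate_def)
  then show ?thesis by blast
qed

text \<open>The easy half of Tutte--Berge. Every edge of a matching meets \<open>U\<close> or lies
  inside one class. The size of a class is not counted but read off an involution \<open>b\<close>
  with at most one fixed point per class: the vertices with \<open>b v < v\<close> number floor(|C|
  / 2). These conditions on \<open>b\<close> concern pairs of vertices only.\<close>

lemma card_matching_le_cover:
  fixes cls b :: "nat \<Rightarrow> nat"
  assumes E: "simple_on n E" and M: "is_matching E M" and U: "U \<subseteq> {..<n}"
    and cls: "\<And>u v. (u, v) \<in> avoiding U E \<Longrightarrow> cls u = cls v"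
    and b: "\<And>v. v \<in> {..<n} - U \<Longrightarrow> b v \<in> {..<n} - U \<and> b (b v) = v \<and> cls (b v) = cls v"
    and fixed: "\<And>u v. u \<in> {..<n} - U \<Longrightarrow> v \<in> {..<n} - U \<Longrightarrow> cls u = cls v \<Longrightarrow> b u = u \<Longrightarrow> b v = v \<Longrightarrow> u = v"
  shows "card M \<le> card {v. v < n \<and> (v \<in> U \<or> b v < v)}"
proof -
  have finE: "finite E" using E by (rule simple_on_finite)
  have finM: "finite M" using M finE matching_finite by blast
  have finU: "finite U" using U finite_subset by blast
  define M1 where "M1 = {e \<in> M. ends e \<inter> U \<noteq> {}}"
  define M2 where "M2 = {e \<in> M. ends e \<inter> U = {}}"
  define A where "A = {v \<in> {..<n} - U. b v < v}"
  have "card M = card M1 + card M2"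
  proof -
    have "M = M1 \<union> M2" "M1 \<inter> M2 = {}" by (auto simp: M1_def M2_def)
    then show ?thesis using finM by (metis card_Un_disjoint finite_Un)
  qed
  moreover have "card M1 \<le> card U"
  proof -
    define g where "g e = (SOME x. x \<in> ends e \<inter> U)" for e
    have g: "g e \<in> ends e \<inter> U" if "e \<in> M1" for e
      using that unfolding g_def by (rule_tac someI_ex) (auto simp: M1_def)
    have "inj_on g M1"
    proof (rule inj_onI)
      fix e f assume ef: "e \<in> M1" "f \<in> M1" "g e = g f"
      then have "g e \<in> ends e" "g e \<in> ends f" using g by fastforce+
      then show "e = f" using matching_unique[OF M] ef by (auto simp: M1_def)
    qed
    moreover have "g ` M1 \<subseteq> U" using g by auto
    ultimately show ?thesis using finU card_inj_on_le by blast
  qed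
  moreover have "card M2 \<le> card A"
  proof -
    have fibre: "card {e \<in> M2. cls (fst e) = c} \<le> card {v \<in> A. cls v = c}" for c
    proof -
      define C where "C = {v \<in> {..<n} - U. cls v = c}"
      define B where "B = {e \<in> M2. cls (fst e) = c}"
      have finC: "finite C" by (simp add: C_def)
      have mB: "is_matching E B" using M by (auto simp: B_def M2_def is_matching_def)
      have "covered B \<subseteq> C"
      proof
        fix x assume "x \<in> covered B"
        then obtain e where e: "e \<in> B" "x \<in> ends e" by (auto simp: covered_def)
        have "e \<in> E" using e(1) mB by (auto simp: is_matching_def)
        have eU: "ends e \<inter> U = {}" using e(1) by (simp add: B_def M2_def)
        have eE: "e \<in> avoiding U E" using \<open>e \<in> E\<close> eU by (simp add: avoiding_def)
        then have "cls (fst e) = cls (snd e)" using cls[of "fst e" "snd e"] by simp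
        moreover have "fst e < snd e" "snd e < n" using \<open>e \<in> E\<close> simple_onD[OF E] by blast+
        moreover have "cls (fst e) = c" using e(1) by (simp add: B_def)
        moreover have "x = fst e \<or> x = snd e" "x \<notin> U" using e(2) eU by auto
        ultimately show "x \<in> C" by (auto simp: C_def)
      qed
      then have 1: "2 * card B \<le> card C" using card_covered[OF E mB] card_mono[OF finC] by metis
      \<comment> \<open>The involution maps \<open>C2\<close> injectively into \<open>C1\<close>,
        and \<open>C3\<close> has at most one element, so 2 |B| <= |C| <= 2 |C1| + 1, which gives
        |B| <= |C1|.\<close>
      define C1 where "C1 = {v \<in> C. b v < v}"
      define C2 where "C2 = {v \<in> C. v < b v}"
      define C3 where "C3 = {v \<in> C. b v = v}"
      have C: "C = C1 \<union> C2 \<union> C3" by (auto simp: C1_def C2_def C3_def)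
      have "card C \<le> card C1 + card C2 + card C3" unfolding C
        by (meson add_mono card_Un_le le_refl le_trans)
      moreover have "card C2 \<le> card C1"
      proof (rule card_inj_on_le)
        show "inj_on b C2" using b by (intro inj_on_inverseI[of _ b]) (auto simp: C2_def C_def)
        show "b ` C2 \<subseteq> C1" using b by (fastforce simp: C2_def C1_def C_def)
        show "finite C1" using finC by (simp add: C1_def)
      qed
      moreover have "card C3 \<le> 1"
        using fixed finC by (subst One_nat_def, subst card_le_Suc0_iff_eq) (auto simp: C3_def C_def)
      ultimately have "card B \<le> card C1" using 1 by linarith
      moreover have "C1 = {v \<in> A. cls v = c}" by (auto simp: C1_def A_def C_def)
      ultimately show ?thesis by (simp add: B_def)
    qed
    define T where "T = (cls \<circ> fst) ` M2 \<union> cls ` A"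
    have fin: "finite T" "finite M2" "finite A" using finM by (auto simp: T_def M2_def A_def)
    have "card M2 = (\<Sum>c\<in>T. card {e \<in> M2. cls (fst e) = c})"
      using sum.group[OF fin(2,1), of "cls \<circ> fst" "\<lambda>_. 1::nat"] by (auto simp: T_def)
    also have "\<dots> \<le> (\<Sum>c\<in>T. card {v \<in> A. cls v = c})" by (intro sum_mono fibre)
    also have "\<dots> = card A"
      using sum.group[OF fin(3,1), of cls "\<lambda>_. 1::nat"] by (auto simp: T_def)
    finally show ?thesis .
  qed
  moreover have "card U + card A = card {v. v < n \<and> (v \<in> U \<or> b v < v)}"
  proof -
    have "{v. v < n \<and> (v \<in> U \<or> b v < v)} = U \<union> A" "U \<inter> A = {}" "finite A" using U by (auto simp: A_def)
    then show ?thesis using finU by (simp add: card_Un_disjoint)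
  qed
  ultimately show ?thesis by linarith
qed

section \<open>The lower bound\<close>

text \<open>Caps the contribution of a single memory state, with decoded set \<open>D\<close>, to
  the potential in the index bound.\<close>

lemma sum_half_power_Pow:
  assumes "finite D"
  shows "(\<Sum>X\<in>Pow D. (1 / 2 :: real) ^ card (D - X)) = (3 / 2) ^ card D"
proof -
  have "(\<Prod>x\<in>D. (1 :: real) + 1 / 2) = (\<Sum>X\<in>Pow D. (\<Prod>x\<in>X. 1) * (\<Prod>x\<in>D - X. 1 / 2))"
    by (rule prod_add[OF assms])
  then show ?thesis by simp
qed

text \<open>The one-way communication lower bound for the index problem: \<open>k = H + 4\<close> independent copies
  of the randomness reduce the error below \<open>1/8\<close> even after a union bound over all help messages
  \<open>W\<close>, so that the help is no longer needed. For the averaged choice \<open>\<rho>\<close> of the randomness, the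
  decoded sets \<open>D\<close> contain the encoded sets \<open>X\<close>, and the potential \<open>\<Sum>X. 2^(-|D - X|)\<close> is
  bounded below by convexity and above by the number of memory states.\<close>

lemma index_memory_bound:
  fixes I :: "'i set" and R :: "'r set" and W :: "'w set"
    and st :: "'r \<Rightarrow> 'i set \<Rightarrow> nat" and acc :: "'r \<Rightarrow> nat \<Rightarrow> 'i \<Rightarrow> 'w \<Rightarrow> bool"
  assumes finI: "finite I" and finR: "finite R" and R0: "R \<noteq> {}" and finW: "finite W"
    and cardW: "card W \<le> 2 ^ (H + 1)"
    and st: "\<And>r X. r \<in> R \<Longrightarrow> X \<subseteq> I \<Longrightarrow> st r X < 2 ^ S"
    and complete: "\<And>X q. X \<subseteq> I \<Longrightarrow> q \<in> X \<Longrightarrow> \<exists>w\<in>W. \<forall>r\<in>R. acc r (st r X) q w"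
    and sound: "\<And>X q w. X \<subseteq> I \<Longrightarrow> q \<in> I - X \<Longrightarrow> w \<in> W \<Longrightarrow>
      3 * card {r \<in> R. acc r (st r X) q w} \<le> card R"
  shows "card I \<le> 16 * ((H + 1) * (S + 1))"
proof -
  define k where "k = H + 4"
  define N where "N = card I"
  define RR where "RR = ({..<k} \<rightarrow>\<^sub>E R)"
  define V where "V = ({..<k} \<rightarrow>\<^sub>E {..<(2::nat) ^ S})"
  define D where "D \<rho> v = {q \<in> I. \<exists>w\<in>W. \<forall>l<k. acc (\<rho> l) (v l) q w}" for \<rho> :: "nat \<Rightarrow> 'r" and v
  define vec where "vec \<rho> X = (\<lambda>l\<in>{..<k}. st (\<rho> l) X)" for \<rho> :: "nat \<Rightarrow> 'r" and X
  have finRR: "finite RR" unfolding RR_def using finR by (intro finite_PiE) auto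
  have cRR: "card RR = card R ^ k" by (simp add: RR_def card_funcsetE)
  have cR: "card R > 0" using finR R0 by (simp add: card_gt_0_iff)
  have finV: "finite V" unfolding V_def by (intro finite_PiE) auto
  have cV: "card V = 2 ^ (S * k)" by (simp add: V_def card_funcsetE power_mult)
  have Dfin: "finite (D \<rho> v)" and Dsub: "D \<rho> v \<subseteq> I" for \<rho> v using finI by (auto simp: D_def)
  have vecV: "vec \<rho> X \<in> V" if "\<rho> \<in> RR" "X \<subseteq> I" for \<rho> X
    using that st by (auto simp: vec_def V_def RR_def)
  have contains: "X \<subseteq> D \<rho> (vec \<rho> X)" if \<rho>: "\<rho> \<in> RR" and X: "X \<subseteq> I" for \<rho> X
  proof
    fix q assume q: "q \<in> X"
    obtain w where "w \<in> W" "\<forall>r\<in>R. acc r (st r X) q w" using complete[OF X q] by blast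
    then show "q \<in> D \<rho> (vec \<rho> X)" using \<rho> X q by (auto simp: D_def vec_def RR_def PiE_def Pi_def)
  qed
  have err1: "8 * card {\<rho> \<in> RR. q \<in> D \<rho> (vec \<rho> X)} \<le> card RR" if X: "X \<subseteq> I" and q: "q \<in> I - X" for X q
  proof -
    define B where "B w = {r \<in> R. acc r (st r X) q w}" for w
    have cB: "2 ^ k * card (B w) ^ k \<le> card R ^ k" if "w \<in> W" for w
    proof -
      \<comment> \<open>The error 1/3 is weakened to 1/2: \<open>k\<close> copies then err with
        probability at most 2^-k, and 2^(H+1) help messages leave 1/8.\<close>
      have "2 * card (B w) \<le> card R" using sound[OF X q that] by (simp add: B_def)
      then show ?thesis by (metis power_mult_distrib power_mono le0)
    qed
    have "{\<rho> \<in> RR. q \<in> D \<rho> (vec \<rho> X)} \<subseteq> (\<Union>w\<in>W. {..<k} \<rightarrow>\<^sub>E B w)"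
      by (auto simp: D_def vec_def RR_def B_def PiE_def Pi_def)
    moreover have "finite (\<Union>w\<in>W. {..<k} \<rightarrow>\<^sub>E B w)"
      using finW finR by (intro finite_UN_I finite_PiE) (auto simp: B_def)
    ultimately have "card {\<rho> \<in> RR. q \<in> D \<rho> (vec \<rho> X)} \<le> card (\<Union>w\<in>W. {..<k} \<rightarrow>\<^sub>E B w)"
      by (intro card_mono) auto
    also have "\<dots> \<le> (\<Sum>w\<in>W. card ({..<k} \<rightarrow>\<^sub>E B w))" using finW by (rule card_UN_le)
    also have "\<dots> = (\<Sum>w\<in>W. card (B w) ^ k)" by (simp add: card_funcsetE)
    finally have "2 ^ k * card {\<rho> \<in> RR. q \<in> D \<rho> (vec \<rho> X)} \<le> (\<Sum>w\<in>W. 2 ^ k * card (B w) ^ k)"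
      by (simp add: sum_distrib_left[symmetric])
    also have "\<dots> \<le> (\<Sum>w\<in>W. card R ^ k)" using cB by (rule sum_mono)
    also have "\<dots> = card W * card R ^ k" by simp
    also have "\<dots> \<le> 2 ^ (H + 1) * card R ^ k" using cardW by (rule mult_le_mono1)
    finally have "2 ^ (H + 1) * (8 * card {\<rho> \<in> RR. q \<in> D \<rho> (vec \<rho> X)}) \<le> 2 ^ (H + 1) * card R ^ k"
      by (simp add: k_def power_add)
    then show ?thesis by (simp add: cRR)
  qed
  define err where "err \<rho> X = card (D \<rho> (vec \<rho> X) - X)" for \<rho> X
  have err2: "8 * (\<Sum>\<rho>\<in>RR. err \<rho> X) \<le> N * card RR" if X: "X \<subseteq> I" for X
  proof -
    have fin: "finite (I - X)" using finI by simp
    have "err \<rho> X = (\<Sum>q\<in>I - X. if q \<in> D \<rho> (vec \<rho> X) then 1 else 0)" for \<rho>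
    proof -
      have "D \<rho> (vec \<rho> X) - X = {q \<in> I - X. q \<in> D \<rho> (vec \<rho> X)}" using Dsub by blast
      then show ?thesis using finI by (simp add: err_def sum.If_cases Int_def)
    qed
    then have "(\<Sum>\<rho>\<in>RR. err \<rho> X) = (\<Sum>q\<in>I - X. \<Sum>\<rho>\<in>RR. if q \<in> D \<rho> (vec \<rho> X) then 1 else 0)"
      by (simp add: sum.swap[of _ "I - X"])
    also have "\<dots> = (\<Sum>q\<in>I - X. card {\<rho> \<in> RR. q \<in> D \<rho> (vec \<rho> X)})"
      using finRR by (simp add: sum.If_cases Int_def)
    finally have "8 * (\<Sum>\<rho>\<in>RR. err \<rho> X) = (\<Sum>q\<in>I - X. 8 * card {\<rho> \<in> RR. q \<in> D \<rho> (vec \<rho> X)})"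
      by (simp add: sum_distrib_left)
    also have "\<dots> \<le> (\<Sum>q\<in>I - X. card RR)" using err1[OF X] by (rule sum_mono)
    also have "\<dots> \<le> N * card RR" using finI by (simp add: N_def card_mono)
    finally show ?thesis .
  qed
  \<comment> \<open>Averaging: summed over all \<open>X\<close>, the error count of some \<rho> is
    at most the mean over \<open>RR\<close>.\<close>
  have "\<exists>\<rho>\<in>RR. 8 * (\<Sum>X\<in>Pow I. err \<rho> X) \<le> N * 2 ^ N"
  proof (rule ccontr)
    assume "\<not> ?thesis"
    then have "N * 2 ^ N < 8 * (\<Sum>X\<in>Pow I. err \<rho> X)" if "\<rho> \<in> RR" for \<rho> using that by (auto simp: not_le)
    moreover have "RR \<noteq> {}" using cRR cR by fastforce
    ultimately have "(\<Sum>\<rho>\<in>RR. N * 2 ^ N) < (\<Sum>\<rho>\<in>RR. 8 * (\<Sum>X\<in>Pow I. err \<rho> X))"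
      using finRR by (intro sum_strict_mono) auto
    also have "\<dots> = (\<Sum>X\<in>Pow I. 8 * (\<Sum>\<rho>\<in>RR. err \<rho> X))"
      by (simp add: sum_distrib_left sum.swap[of _ RR])
    also have "\<dots> \<le> (\<Sum>X\<in>Pow I. N * card RR)" using err2 by (intro sum_mono) auto
    also have "\<dots> = 2 ^ N * (N * card RR)" using finI by (simp add: N_def card_Pow)
    finally show False by (simp add: algebra_simps)
  qed
  then obtain \<rho> where \<rho>: "\<rho> \<in> RR" and avg: "8 * (\<Sum>X\<in>Pow I. err \<rho> X) \<le> N * 2 ^ N" by blast
  define z where "z = (1 / 2 :: real)"
  have "2 ^ N * 2 powr (- real N / 8) \<le> (\<Sum>X\<in>Pow I. z ^ err \<rho> X)"
  proof -
    \<comment> \<open>The tangent to 2^-e at e = N/8. As the errors average at most N/8 over all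
      \<open>X\<close>, the linear terms have a nonnegative sum; this is Jensen's inequality made
      explicit.\<close>
    have tangent: "2 powr (- real N / 8) * (1 + (real N / 8 - real e) * ln 2) \<le> z ^ e" for e :: nat
    proof -
      have "1 + (real N / 8 - real e) * ln 2 \<le> 2 powr (real N / 8 - real e)"
        unfolding powr_def by (simp add: mult.commute)
      then have "2 powr (- real N / 8) * (1 + (real N / 8 - real e) * ln 2) \<le>
          2 powr (- real N / 8) * 2 powr (real N / 8 - real e)" by (intro mult_left_mono) auto
      also have "\<dots> = 2 powr (- real e)" by (simp flip: powr_add)
      also have "\<dots> = z ^ e" by (simp add: z_def powr_minus powr_realpow power_one_over inverse_eq_divide)
      finally show ?thesis .
    qed
    have cP: "card (Pow I) = 2 ^ N" using finI by (simp add: N_def card_Pow)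
    have "real (8 * (\<Sum>X\<in>Pow I. err \<rho> X)) \<le> real (N * 2 ^ N)" using avg by (simp only: of_nat_le_iff)
    then have "0 \<le> real N / 8 * 2 ^ N - (\<Sum>X\<in>Pow I. real (err \<rho> X))" by simp
    also have "\<dots> = (\<Sum>X\<in>Pow I. real N / 8 - real (err \<rho> X))"
      by (simp add: sum_subtractf cP)
    finally have nn: "0 \<le> (\<Sum>X\<in>Pow I. real N / 8 - real (err \<rho> X))" .
    have "2 ^ N \<le> 2 ^ N + (\<Sum>X\<in>Pow I. real N / 8 - real (err \<rho> X)) * ln 2" using nn by simp
    also have "\<dots> = (\<Sum>X\<in>Pow I. 1 + (real N / 8 - real (err \<rho> X)) * ln 2)"
      by (simp add: sum.distrib cP sum_distrib_right)
    finally have "2 powr (- real N / 8) * 2 ^ N \<le>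
        2 powr (- real N / 8) * (\<Sum>X\<in>Pow I. 1 + (real N / 8 - real (err \<rho> X)) * ln 2)"
      by (intro mult_left_mono) auto
    also have "\<dots> = (\<Sum>X\<in>Pow I. 2 powr (- real N / 8) * (1 + (real N / 8 - real (err \<rho> X)) * ln 2))"
      by (rule sum_distrib_left)
    also have "\<dots> \<le> (\<Sum>X\<in>Pow I. z ^ err \<rho> X)" by (intro sum_mono tangent)
    finally show ?thesis by (simp add: mult.commute)
  qed
  \<comment> \<open>Sets \<open>X\<close> with the same memory contents share the decoded set and
    are all contained in it, so each fibre may be enlarged to the power set of that decoded
    set.\<close>
  also have "(\<Sum>X\<in>Pow I. z ^ err \<rho> X) = (\<Sum>v\<in>V. \<Sum>X | X \<in> Pow I \<and> vec \<rho> X = v. z ^ err \<rho> X)"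
    using finI finV vecV[OF \<rho>] by (intro sum.group[symmetric]) auto
  also have "\<dots> \<le> (\<Sum>v\<in>V. \<Sum>X\<in>Pow (D \<rho> v). z ^ card (D \<rho> v - X))"
  proof (rule sum_mono)
    fix v
    have "(\<Sum>X | X \<in> Pow I \<and> vec \<rho> X = v. z ^ err \<rho> X) =
        (\<Sum>X | X \<in> Pow I \<and> vec \<rho> X = v. z ^ card (D \<rho> v - X))" by (simp add: err_def)
    also have "\<dots> \<le> (\<Sum>X\<in>Pow (D \<rho> v). z ^ card (D \<rho> v - X))"
      using Dfin contains[OF \<rho>] by (intro sum_mono2) (auto simp: z_def)
    finally show "(\<Sum>X | X \<in> Pow I \<and> vec \<rho> X = v. z ^ err \<rho> X) \<le> \<dots>" .
  qed
  also have "\<dots> = (\<Sum>v\<in>V. (3 / 2) ^ card (D \<rho> v))"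
    unfolding z_def using Dfin by (simp add: sum_half_power_Pow)
  also have "\<dots> \<le> (\<Sum>v\<in>V. (3 / 2) ^ N)"
    using card_mono[OF finI Dsub] by (intro sum_mono power_increasing) (auto simp: N_def)
  also have "\<dots> = 2 ^ (S * k) * (3 / 2) ^ N" by (simp add: cV)
  finally have main: "2 ^ N * 2 powr (- real N / 8) \<le> 2 ^ (S * k) * (3 / 2 :: real) ^ N" .
  \<comment> \<open>From (3/2)^5 < 8 follows (3/2)^N <= 2^(3N/5). Since 1 - 1/8 - 3/5 = 11/40
    exceeds 1/4, comparing exponents gives N <= 4 S k.\<close>
  have "ln ((3 / 2) ^ 5) \<le> ln ((2::real) ^ 3)" by (subst ln_le_cancel_iff) (auto simp: power_divide)
  then have ln: "5 * ln (3 / 2) \<le> 3 * ln (2::real)" by (simp only: ln_realpow[of "3 / 2"] ln_realpow[of 2])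
  have "(3 / 2 :: real) ^ N = exp (real N * ln (3 / 2))" by (simp add: exp_of_nat_mult)
  also have "\<dots> \<le> exp (real N * (3 / 5 * ln 2))"
    unfolding exp_le_cancel_iff using ln by (intro mult_left_mono) auto
  also have "\<dots> = 2 powr (3 / 5 * real N)" by (simp add: powr_def)
  finally have "2 ^ (S * k) * (3 / 2 :: real) ^ N \<le> 2 ^ (S * k) * 2 powr (3 / 5 * real N)"
    by (intro mult_left_mono) auto
  with main have le: "2 ^ N * 2 powr (- real N / 8) \<le> 2 ^ (S * k) * 2 powr (3 / 5 * real N)" by linarith
  have p: "2 powr real i = (2::real) ^ i" for i by (rule powr_realpow) simp
  have e1: "2 powr (real N + - real N / 8) = 2 ^ N * 2 powr (- real N / 8)"
    by (simp only: powr_add p)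
  have e2: "2 powr (real (S * k) + 3 / 5 * real N) = 2 ^ (S * k) * 2 powr (3 / 5 * real N)"
    by (simp only: powr_add p)
  have "2 powr (real N + - real N / 8) \<le> (2::real) powr (real (S * k) + 3 / 5 * real N)"
    unfolding e1 e2 by (rule le)
  then have "real N + - real N / 8 \<le> real (S * k) + 3 / 5 * real N"
    by (rule powr_le_cancel_iff[THEN iffD1, rotated]) simp
  moreover have "0 \<le> real (S * k)" "0 \<le> real N" by (rule of_nat_0_le_iff)+
  ultimately have "real N \<le> 4 * real (S * k)" by linarith
  also have "\<dots> = real (4 * (S * k))" by (simp only: of_nat_mult of_nat_numeral)
  finally have "real N \<le> real (4 * (S * k))" .
  then have "N \<le> 4 * (S * k)" by (simp only: of_nat_le_iff)
  also have "4 * (S * k) \<le> 4 * ((S + 1) * (4 * (H + 1)))" unfolding k_def by (intro mult_le_mono) auto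
  finally show ?thesis by (simp add: N_def algebra_simps)
qed

section \<open>Graphs that encode the index problem\<close>

lemma max_matching_size_eq: "max_matching_size \<sigma> = matching_number (set \<sigma>)"
  by (simp add: max_matching_size_def matching_number_def)

lemma valid_stream_iff: "valid_stream n \<sigma> \<longleftrightarrow> distinct \<sigma> \<and> simple_on n (set \<sigma>)"
  by (simp add: valid_stream_def simple_on_def)

definition index_stream :: "nat \<Rightarrow> (nat \<times> nat) set \<Rightarrow> (nat \<times> nat) list" where
  "index_stream m X = map (\<lambda>(i, j). (i, m + j)) (SOME xs. set xs = X \<and> distinct xs)"

text \<open>The vertices a_k = k and b_k = m + k carry the stored graph; 2m + k and 3m + k are their
  private leaves, so 4m vertices suffice.\<close>

definition query_stream :: "nat \<Rightarrow> nat \<times> nat \<Rightarrow> (nat \<times> nat) list" where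
  "query_stream m q =
     map (\<lambda>k. (k, 2 * m + k)) (filter (\<lambda>k. k \<noteq> fst q) [0..<m]) @
     map (\<lambda>k. (m + k, 3 * m + k)) (filter (\<lambda>k. k \<noteq> snd q) [0..<m])"

lemma index_stream:
  assumes "X \<subseteq> {..<m} \<times> {..<m}"
  shows "set (index_stream m X) = (\<lambda>(i, j). (i, m + j)) ` X" "distinct (index_stream m X)"
proof -
  have "finite X" using assms by (rule finite_subset) auto
  then have "\<exists>xs. set xs = X \<and> distinct xs" by (rule finite_distinct_list)
  then have *: "set (SOME xs. set xs = X \<and> distinct xs) = X \<and> distinct (SOME xs. set xs = X \<and> distinct xs)"
    by (rule someI_ex)
  then show "set (index_stream m X) = (\<lambda>(i, j). (i, m + j)) ` X" by (simp add: index_stream_def)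
  show "distinct (index_stream m X)" using * by (auto simp: index_stream_def distinct_map inj_on_def)
qed

lemma valid_index_query:
  assumes "X \<subseteq> {..<m} \<times> {..<m}" "4 * m \<le> n"
  shows "valid_stream n (index_stream m X @ query_stream m q)"
proof -
  have "set (index_stream m X) \<inter> set (query_stream m q) = {}"
    using assms by (auto simp: index_stream query_stream_def)
  moreover have "distinct (query_stream m q)"
    by (auto simp: query_stream_def distinct_map inj_on_def)
  ultimately show ?thesis using assms(2) index_stream[OF assms(1)] assms(1)
    by (auto simp: valid_stream_def query_stream_def)
qed

text \<open>The pendant edges form a matching, which leaves only a_i and b_j free; the edge between
  these, if present, extends it. Optimality comes from a vertex cover \<open>U\<close> of the same
  size: all vertices with a pendant edge, and also a_i if the queried edge exists. With
  \<open>U\<close> a cover, the classes and the involution can be the identity.\<close>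

lemma max_matching_size_index_query:
  assumes X: "X \<subseteq> {..<m} \<times> {..<m}" and q: "q \<in> {..<m} \<times> {..<m}"
  shows "max_matching_size (index_stream m X @ query_stream m q) = 2 * (m - 1) + (if q \<in> X then 1 else 0)"
proof -
  obtain i j where ij: "q = (i, j)" "i < m" "j < m" using q by auto
  define \<sigma> where "\<sigma> = index_stream m X @ query_stream m q"
  define E where "E = set \<sigma>"
  define P1 where "P1 = (\<lambda>k. (k, 2 * m + k)) ` ({..<m} - {i})"
  define P2 where "P2 = (\<lambda>k. (m + k, 3 * m + k)) ` ({..<m} - {j})"
  have EX: "E = (\<lambda>(i, j). (i, m + j)) ` X \<union> P1 \<union> P2"
    using index_stream(1)[OF X] by (auto simp: E_def \<sigma>_def query_stream_def ij P1_def P2_def)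
  have E: "simple_on (4 * m) E" using valid_index_query[OF X, of "4 * m" q]
    by (simp add: valid_stream_iff E_def \<sigma>_def)
  have finE: "finite E" by (simp add: E_def)
  have nE: "max_matching_size \<sigma> = matching_number E" by (simp add: max_matching_size_eq E_def)
  define U where "U = ({..<2 * m} - {i, m + j}) \<union> (if q \<in> X then {i} else {})"
  have cU: "card U = 2 * (m - 1) + (if q \<in> X then 1 else 0)"
  proof -
    have "card ({..<2 * m} - {i, m + j}) = 2 * m - 2" using ij by (subst card_Diff_subset) auto
    moreover have "i \<notin> {..<2 * m} - {i, m + j}" by simp
    ultimately show ?thesis using ij by (auto simp: U_def)
  qed
  have noU: "avoiding U E = {}"
    using X ij by (auto simp: avoiding_def U_def EX P1_def P2_def split: if_splits)
  have Usub: "U \<subseteq> {..<4 * m}" using ij by (auto simp: U_def)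
  have "matching_number E \<le> card U"
  proof -
    obtain M where M: "is_max_matching E M" using finE by (rule max_matching_exists)
    then have "is_matching E M" by (simp add: is_max_matching_def)
    then have "card M \<le> card {v. v < 4 * m \<and> (v \<in> U \<or> id v < v)}"
      by (rule card_matching_le_cover[OF E, where cls = id]) (use Usub in \<open>auto simp: noU\<close>)
    also have "\<dots> \<le> card U" by (intro card_mono) (auto simp: U_def)
    finally show ?thesis using M by (simp add: is_max_matching_def)
  qed
  moreover have "card U \<le> matching_number E"
  proof -
    define M where "M = P1 \<union> P2 \<union> (if q \<in> X then {(i, m + j)} else {})"
    have "is_matching E M" using ij
      by (auto simp: is_matching_def M_def EX P1_def P2_def split: if_splits)
    then have "card M \<le> matching_number E" by (rule card_matching_le[OF finE])
    moreover have "card P1 = m - 1" "card P2 = m - 1"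
      unfolding P1_def P2_def using ij by (subst card_image; simp add: inj_on_def)+
    moreover have "P1 \<inter> P2 = {}" "finite P1" "finite P2" "(i, m + j) \<notin> P1 \<union> P2"
      using ij by (auto simp: P1_def P2_def)
    ultimately show ?thesis by (cases "q \<in> X") (simp_all add: M_def cU card_Un_disjoint)
  qed
  ultimately show ?thesis using nE cU by (simp add: \<sigma>_def)
qed

lemma foldl_bounded:
  "x < b \<Longrightarrow> (\<And>y e. f y e < b) \<Longrightarrow> foldl f x xs < (b::nat)"
  by (induction xs arbitrary: x) auto

text \<open>The memory after \<open>index_stream\<close> is the message about the set
  \<open>X\<close>; the decoder runs the query edges and a help message on it. Acceptance means the
  output 2(m-1)+1, which is correct for q in \<open>X\<close> and a soundness error
  otherwise.\<close>

lemma scheme_lower_bound: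
  assumes P: "is_scheme_for max_matching_size n P" and H: "help_bounded P n H" and S: "space_bounded P S"
    and m: "4 * m \<le> n"
  shows "m\<^sup>2 \<le> 16 * ((H + 1) * (S + 1))"
proof -
  define I where "I = {..<m} \<times> {..<m}"
  define R where "R = {\<rho>::bool list. length \<rho> = rbits P}"
  define W where "W = {w::bool list. length w \<le> H}"
  define st where "st \<rho> X = foldl (vstep P \<rho>) (vinit P \<rho>) (index_stream m X)" for \<rho> X
  define acc where "acc \<rho> x q w \<longleftrightarrow>
     vout P \<rho> (foldl (vhelp P \<rho>) (foldl (vstep P \<rho>) x (query_stream m q)) w) = Some (2 * (m - 1) + 1)" for \<rho> x q w
  have run: "acc \<rho> (st \<rho> X) q w \<longleftrightarrow>
      run_scheme P \<rho> (index_stream m X @ query_stream m q) w = Some (2 * (m - 1) + 1)" for \<rho> X q w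
    by (simp add: acc_def st_def run_scheme_def)
  have cR: "card R = 2 ^ rbits P" and finR: "finite R"
    using card_lists_length_eq[of "UNIV :: bool set" "rbits P"] finite_lists_length_eq[of "UNIV :: bool set" "rbits P"]
    by (simp_all add: R_def)
  have finW: "finite W" using finite_lists_length_le[of "UNIV :: bool set" H] by (simp add: W_def)
  have "card W = (\<Sum>i\<le>H. 2 ^ i)" using card_lists_length_le[of "UNIV :: bool set" H] by (simp add: W_def)
  also have "\<dots> \<le> 2 ^ (H + 1)" by (induction H) auto
  finally have cW: "card W \<le> 2 ^ (H + 1)" .
  have "card I \<le> 16 * ((H + 1) * (S + 1))"
  proof (rule index_memory_bound[where R = R and W = W and st = st and acc = acc])
    show "R \<noteq> {}" using cR by force
    show "st r X < 2 ^ S" for r X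
      unfolding st_def using S by (intro foldl_bounded) (auto simp: space_bounded_def)
    show "\<exists>w\<in>W. \<forall>r\<in>R. acc r (st r X) q w" if "X \<subseteq> I" "q \<in> X" for X q
    proof
      let ?\<sigma> = "index_stream m X @ query_stream m q"
      have v: "valid_stream n ?\<sigma>" using that m by (intro valid_index_query) (auto simp: I_def)
      show "prover P ?\<sigma> \<in> W" using H v by (simp add: W_def help_bounded_def)
      have "max_matching_size ?\<sigma> = 2 * (m - 1) + 1"
        using that by (subst max_matching_size_index_query) (auto simp: I_def)
      then show "\<forall>r\<in>R. acc r (st r X) q (prover P ?\<sigma>)" using P v by (simp add: run is_scheme_for_def R_def)
    qed
    show "3 * card {r \<in> R. acc r (st r X) q w} \<le> card R" if "X \<subseteq> I" "q \<in> I - X" for X q w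
    proof -
      let ?\<sigma> = "index_stream m X @ query_stream m q"
      have v: "valid_stream n ?\<sigma>" using that m by (intro valid_index_query) (auto simp: I_def)
      have f: "max_matching_size ?\<sigma> = 2 * (m - 1)"
        using that by (subst max_matching_size_index_query) (auto simp: I_def)
      have "card {r \<in> R. acc r (st r X) q w} \<le>
          card {\<rho>. length \<rho> = rbits P \<and> run_scheme P \<rho> ?\<sigma> w \<notin> {Some (max_matching_size ?\<sigma>), None}}"
        using finR by (intro card_mono) (auto simp: R_def run f)
      moreover have "3 * card {\<rho>. length \<rho> = rbits P \<and> run_scheme P \<rho> ?\<sigma> w \<notin> {Some (max_matching_size ?\<sigma>), None}}
          \<le> 2 ^ rbits P" using P v unfolding is_scheme_for_def by blast
      ultimately show ?thesis using cR by linarith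
    qed
  qed (use finR finW cW in \<open>auto simp: I_def\<close>)
  then show ?thesis by (simp add: I_def power2_eq_square)
qed

lemma matching_lower_bound:
  "\<exists>d::real. d > 0 \<and> (\<exists>N. \<forall>n \<ge> N. \<forall>P H S.
      is_scheme_for max_matching_size n P \<and> help_bounded P n H \<and> space_bounded P S
      \<longrightarrow> real ((H + 1) * (S + 1)) \<ge> d * real n ^ 2)"
\<comment> \<open>For n >= 4 the choice m = n div 4 satisfies n <= 8m, so n^2 <= 64 m^2; and 1024 =
  64 times 16.\<close>
proof (rule exI[of _ "1 / 1024"], intro conjI exI[of _ 4] allI impI, goal_cases)
  case 1
  show ?case by simp
next
  case (2 n P H S)
  then have P: "is_scheme_for max_matching_size n P" "help_bounded P n H" "space_bounded P S" by auto
  define m where "m = n div 4"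
  have "n \<le> 8 * m" using 2(1) unfolding m_def by presburger
  then have "n\<^sup>2 \<le> (8 * m)\<^sup>2" by (intro power_mono) auto
  also have "\<dots> = 64 * m\<^sup>2" by (simp add: power_mult_distrib)
  also have "\<dots> \<le> 64 * (16 * ((H + 1) * (S + 1)))"
    by (intro mult_le_mono2 scheme_lower_bound[OF P]) (simp add: m_def)
  finally have "real (n\<^sup>2) \<le> real (1024 * ((H + 1) * (S + 1)))" by (simp only: of_nat_le_iff)
  then show ?case by simp
qed

section \<open>Primes and roots of polynomials modulo a prime\<close>

text \<open>Leibniz' harmonic triangle with entries 1 / ((n+1) C(n,k)): each entry is the sum of the
  two below it.\<close>

lemma leibniz_triangle_rec:
  assumes "k \<le> n"
  shows "1 / (real (n + 2) * real (Suc n choose Suc k)) =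
    1 / (real (n + 1) * real (n choose k)) - 1 / (real (n + 2) * real (Suc n choose k))"
proof -
  define a where "a = (fact k :: real)"
  define b where "b = (fact (n - k) :: real)"
  define c where "c = (fact n :: real)"
  have pos: "a > 0" "b > 0" "c > 0" by (simp_all add: a_def b_def c_def)
  have 1: "real (n choose k) = c / (a * b)"
    using assms by (simp add: binomial_fact a_def b_def c_def)
  have 2: "real (Suc n choose Suc k) = real (Suc n) * c / (real (Suc k) * a * b)"
    using assms by (subst binomial_fact) (simp_all add: a_def b_def c_def)
  have 3: "real (Suc n choose k) = real (Suc n) * c / (a * (real (n - k) + 1) * b)"
    using assms by (subst binomial_fact) (simp_all add: a_def b_def c_def Suc_diff_le algebra_simps)
  have 4: "real (n - k) = real n - real k" using assms by simp
  have "real n - real k + 1 > 0" using assms by simp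
  then show ?thesis unfolding 1 2 3 4 using pos by (simp add: divide_simps) (simp add: algebra_simps)
qed

text \<open>Divisibility makes \<open>D\<close> times the border entries 1/(n+1) integral, and the
  recurrence carries integrality inwards by subtraction.\<close>

lemma leibniz_triangle_Ints:
  fixes D n k :: nat
  assumes "\<And>j. 1 \<le> j \<Longrightarrow> j \<le> n + 1 \<Longrightarrow> j dvd D" "k \<le> n"
  shows "real D / (real (n + 1) * real (n choose k)) \<in> \<int>"
  using assms
proof (induction n arbitrary: k)
  case 0
  then show ?case by simp
next
  case (Suc n)
  note IH = Suc.IH and dvd = Suc.prems(1)
  show ?case using \<open>k \<le> Suc n\<close>
  proof (induction k)
    case 0
    have "(n + 2) dvd D" using dvd[of "n + 2"] by simp
    then obtain e where "D = (n + 2) * e" by (elim dvdE)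
    then have "real D = real (n + 2) * real e" by (simp only: of_nat_mult)
    then have "real D / real (n + 2) = real e" by simp
    then show ?case by simp
  next
    case (Suc k)
    have k: "k \<le> n" using Suc.prems by simp
    have i1: "real D / (real (n + 1) * real (n choose k)) \<in> \<int>"
      by (rule IH[OF _ k]) (use dvd in auto)
    have i2: "real D / (real (Suc n + 1) * real (Suc n choose k)) \<in> \<int>"
      using Suc.IH k by simp
    have "real D / (real (Suc n + 1) * real (Suc n choose Suc k)) =
       real D / (real (n + 1) * real (n choose k)) - real D / (real (Suc n + 1) * real (Suc n choose k))"
      using arg_cong[OF leibniz_triangle_rec[OF k], of "\<lambda>x. real D * x"]
      by (simp add: right_diff_distrib)
    then show ?case using i1 i2 by (metis Ints_diff)
  qed
qed

text \<open>With n = N - 1, \<open>D\<close> is a positive multiple of (n+1) C(n, n div 2), and the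
  middle coefficient is the largest of the n + 1 binomial coefficients with sum 2^n.\<close>

lemma common_multiple_ge:
  fixes D N :: nat
  assumes "\<And>j. 1 \<le> j \<Longrightarrow> j \<le> N \<Longrightarrow> j dvd D" "N > 0" "D > 0"
  shows "2 ^ (N - 1) \<le> D"
proof -
  define n where "n = N - 1"
  define c where "c = n choose (n div 2)"
  have N: "N = n + 1" using assms(2) by (simp add: n_def)
  have cpos: "c > 0" unfolding c_def by simp
  have "real D / (real (n + 1) * real c) \<in> \<int>"
    unfolding c_def by (rule leibniz_triangle_Ints) (use assms(1) N in auto)
  then obtain z where z: "real D / (real (n + 1) * real c) = of_int z" by (elim Ints_cases)
  have "real D / (real (n + 1) * real c) > 0" using assms(3) cpos by simp
  then have "z \<ge> 1" using z by (metis of_int_0_less_iff int_one_le_iff_zero_less)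
  then have "1 \<le> real D / (real (n + 1) * real c)" using z by simp
  moreover have "real (n + 1) * real c > 0" using cpos by simp
  ultimately have "real (n + 1) * real c \<le> real D" using le_divide_eq_1_pos by blast
  then have "(n + 1) * c \<le> D" by (metis of_nat_le_iff of_nat_mult)
  moreover have "(2::nat) ^ n = (\<Sum>k\<le>n. n choose k)" by (simp add: choose_row_sum)
  moreover have "(\<Sum>k\<le>n. n choose k) \<le> (\<Sum>k\<le>n. c)"
    unfolding c_def by (intro sum_mono binomial_maximum)
  ultimately show ?thesis by (simp add: n_def)
qed

text \<open>A weak form of Bertrand's postulate that keeps the bit length of the prime in O(b).
  Without such a prime, all numbers up to N = 2^(2b+4) have only prime factors up to 2^b. They then
  have a common multiple \<open>D\<close> that is a product of at most 2^b prime powers, each at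
  most N, which is less than the 2^(N-1) required of a common multiple.\<close>

lemma exists_prime_between_powers: "\<exists>p::nat. prime p \<and> 2 ^ b < p \<and> p \<le> 2 ^ (2 * b + 4)"
proof (rule ccontr)
  assume no: "\<not> ?thesis"
  define N :: nat where "N = 2 ^ (2 * b + 4)"
  define P where "P = {p::nat. prime p \<and> p \<le> 2 ^ b}"
  define e where "e p = (GREATEST e. p ^ e \<le> N)" for p :: nat
  define D where "D = (\<Prod>p\<in>P. p ^ e p)"
  have Npos: "N > 0" by (simp add: N_def)
  have finP: "finite P" by (rule finite_subset[of _ "{..2 ^ b}"]) (auto simp: P_def)
  have bound: "i < N" if "p ^ i \<le> N" "p \<ge> 2" for p i
  proof -
    have "i < 2 ^ i" by simp
    also have "2 ^ i \<le> p ^ i" using that by (intro power_mono) auto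
    finally show ?thesis using that by simp
  qed
  have e1: "p ^ e p \<le> N" if "p \<ge> 2" for p
    unfolding e_def using bound[OF _ that] Npos
    by (intro GreatestI_nat[of "\<lambda>i. p ^ i \<le> N" 0 N]) (auto intro: less_imp_le)
  have e2: "i \<le> e p" if "p ^ i \<le> N" "p \<ge> 2" for p i
    unfolding e_def using bound[OF _ that(2)] that
    by (intro Greatest_le_nat[of "\<lambda>i. p ^ i \<le> N" i N]) (auto intro: less_imp_le)
  have P2: "p \<ge> 2" if "p \<in> P" for p using that prime_ge_2_nat by (auto simp: P_def)
  have Dpos: "D > 0" unfolding D_def using P2 by (intro prod_pos) (fastforce dest: P2)
  have "j dvd D" if j: "1 \<le> j" "j \<le> N" for j
  proof -
    have "j = (\<Prod>p\<in>prime_factors j. p ^ multiplicity p j)"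
      using j by (simp add: prime_factorization_nat)
    also have "\<dots> dvd (\<Prod>p\<in>P. p ^ e p)"
    proof (rule prod_dvd_prod_subset2)
      show "prime_factors j \<subseteq> P"
      proof
        fix p assume p: "p \<in> prime_factors j"
        then have "p dvd j" "prime p" by auto
        then have "p \<le> N" using j by (meson dvd_imp_le le_trans less_le_trans zero_less_one)
        then show "p \<in> P" using no \<open>prime p\<close> by (simp add: P_def N_def) (metis not_le)
      qed
      fix p assume p: "p \<in> prime_factors j"
      have "p ^ multiplicity p j \<le> j" using j by (intro dvd_imp_le multiplicity_dvd) auto
      then have "multiplicity p j \<le> e p" using p j prime_ge_2_nat by (intro e2) auto
      then show "p ^ multiplicity p j dvd p ^ e p" by (rule le_imp_power_dvd)
    qed (use finP in auto)
    finally show ?thesis by (simp add: D_def)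
  qed
  then have c1: "2 ^ (N - 1) \<le> D" by (rule common_multiple_ge) (use Npos Dpos in auto)
  have "D \<le> (\<Prod>p\<in>P. N)" unfolding D_def using e1 P2 by (intro prod_mono) auto
  then have c2: "D \<le> N ^ card P" by simp
  have "P \<subseteq> {1..2 ^ b}"
  proof
    fix p assume "p \<in> P"
    then show "p \<in> {1..2 ^ b}" using P2[of p] by (simp add: P_def)
  qed
  then have "card P \<le> card {1..(2::nat) ^ b}" by (intro card_mono) auto
  then have "N ^ card P \<le> N ^ (2 ^ b)" using Npos by (intro power_increasing) auto
  also have "N ^ (2 ^ b) = 2 ^ ((2 * b + 4) * 2 ^ b)" unfolding N_def by (rule power_mult[symmetric])
  finally have "(2::nat) ^ (N - 1) \<le> 2 ^ ((2 * b + 4) * 2 ^ b)" using c1 c2 by (meson le_trans)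
  \<comment> \<open>Since N = 16 * 4^b, this contradicts (2b+4) 2^b <= 6 * 4^b.\<close>
  then have "N - 1 \<le> (2 * b + 4) * 2 ^ b" by (subst (asm) power_increasing_iff) auto
  moreover have "b < 2 ^ b" by simp
  then have "2 * b + 4 \<le> 6 * 2 ^ b" by linarith
  then have "(2 * b + 4) * 2 ^ b \<le> (6 * 2 ^ b) * 2 ^ b" by (rule mult_le_mono1)
  moreover have "N = 16 * (2 ^ b * 2 ^ b)" by (simp add: N_def power_add power_mult power2_eq_square mult.commute[of 2 b])
  moreover have "(2::nat) ^ b * 2 ^ b \<ge> 1" by simp
  ultimately show False by linarith
qed

text \<open>The usual root count over a field, carried out on integer polynomials with
  \<open>zero' read as\<close>divisible by p': synthetic division splits off a root \<open>a\<close>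
  with a remainder divisible by \<open>p\<close>, and primality of \<open>p\<close> sends every
  other root to the quotient.\<close>

lemma card_roots_mod_prime_le:
  fixes f :: "int poly" and p :: nat
  assumes "prime p" "\<not> int p dvd coeff f i"
  shows "card {x. x < p \<and> int p dvd poly f (int x)} \<le> degree f"
  using assms(2)
proof (induction "degree f" arbitrary: f i rule: less_induct)
  case less
  define A where "A f = {x. x < p \<and> int p dvd poly f (int x)}" for f
  have p: "prime (int p)" using assms(1) by simp
  show ?case
  proof (cases "A f = {}")
    case True
    then have "card (A f) \<le> degree f" by simp
    then show ?thesis by (simp only: A_def)
  next
    case False
    then obtain a where a: "a < p" "int p dvd poly f (int a)" by (auto simp: A_def)
    define q where "q = synthetic_div f (int a)"
    have f: "f = [:- int a, 1:] * q + [:poly f (int a):]"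
      unfolding q_def by (rule synthetic_div_correct'[symmetric])
    have ex: "\<exists>i. \<not> int p dvd coeff q i"
    proof (rule ccontr)
      assume h: "\<not> ?thesis"
      have "coeff f i = coeff ([:- int a, 1:] * q + [:poly f (int a):]) i" using f by simp
      also have "int p dvd \<dots>" using h a by (cases i) (auto simp: coeff_pCons)
      finally show False using less.prems by simp
    qed
    have deg: "degree f \<noteq> 0"
    proof
      assume "degree f = 0"
      then obtain c where "f = [:c:]" by (rule degree_eq_zeroE)
      then show False using a less.prems by (cases i) auto
    qed
    have dq: "degree q = degree f - 1" by (simp add: q_def degree_synthetic_div)
    then have "card (A q) \<le> degree q"
      using less.hyps[of q] ex deg unfolding A_def by auto
    moreover have "A f \<subseteq> insert a (A q)"
    proof
      fix x assume x: "x \<in> A f"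
      have "poly f (int x) = (int x - int a) * poly q (int x) + poly f (int a)"
        by (subst (1) f) (simp add: left_diff_distrib)
      then have "int p dvd (int x - int a) * poly q (int x)"
        using x a by (auto simp: A_def dvd_add_left_iff)
      then consider "int p dvd int x - int a" | "int p dvd poly q (int x)"
        using p prime_dvd_mult_iff by blast
      then show "x \<in> insert a (A q)"
      proof cases
        case 1
        have "x < p" using x by (simp add: A_def)
        have "x = a" 
        proof (rule ccontr)
          assume "x \<noteq> a"
          then have "\<bar>int x - int a\<bar> \<ge> \<bar>int p\<bar>" using 1 by (intro dvd_imp_le_int) auto
          then show False using \<open>x < p\<close> a by linarith
        qed
        then show ?thesis by simp
      next
        case 2
        then show ?thesis using x by (simp add: A_def)
      qed
    qed
    moreover have "finite (A q)" by (simp add: A_def)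
    ultimately have "card (A f) \<le> card (insert a (A q))" by (intro card_mono) auto
    also have "\<dots> \<le> Suc (card (A q))" by (simp add: \<open>finite (A q)\<close> card_insert_if)
    finally have "card (A f) \<le> Suc (degree q)" using \<open>card (A q) \<le> degree q\<close> by simp
    then show ?thesis using deg dq by (simp add: A_def)
  qed
qed

section \<open>Verifiers with additive memory\<close>

definition block :: "nat \<Rightarrow> bool list \<Rightarrow> nat \<Rightarrow> bool list" where
  "block L w k = take L (drop (k * L) w)"

text \<open>The memory is a linear sketch of \<open>d\<close> residues modulo \<open>p\<close>. A
  stream token adds the vector \<open>\<alpha>\<close>, and each of the \<open>m\<close> help blocks
  of \<open>L\<close> bits adds a vector \<open>\<beta>\<close> that may depend on its position. The
  help is thus read in one pass, with only the current block buffered.\<close>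

locale sketch_verifier =
  fixes L m d p :: nat
    and \<alpha> :: "bool list \<Rightarrow> nat \<times> nat \<Rightarrow> nat \<Rightarrow> int"
    and \<beta> :: "bool list \<Rightarrow> nat \<Rightarrow> bool list \<Rightarrow> nat \<Rightarrow> int"
    and out :: "bool list \<Rightarrow> (nat \<Rightarrow> int) \<Rightarrow> nat option"
  assumes L: "L > 0" and p: "p > 0"
begin

definition accumulate :: "(nat \<Rightarrow> int) \<Rightarrow> (nat \<Rightarrow> int) \<Rightarrow> nat \<Rightarrow> int" where
  "accumulate v a = (\<lambda>c\<in>{..<d}. (v c + a c) mod int p)"

definition start :: "nat \<times> bool list \<times> (nat \<Rightarrow> int)" where
  "start = (0, [], \<lambda>c\<in>{..<d}. 0)"

fun token_step :: "bool list \<Rightarrow> nat \<times> bool list \<times> (nat \<Rightarrow> int) \<Rightarrow> nat \<times> nat \<Rightarrow> nat \<times> bool list \<times> (nat \<Rightarrow> int)" where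
  "token_step \<rho> (k, buf, v) e = (k, buf, accumulate v (\<alpha> \<rho> e))"

text \<open>The counter value \<open>m\<close> means that all blocks are complete; one further bit
  leads to the sink \<open>Suc m\<close>, so overlong help is recognised without counting its
  length.\<close>

fun bit_step :: "bool list \<Rightarrow> nat \<times> bool list \<times> (nat \<Rightarrow> int) \<Rightarrow> bool \<Rightarrow> nat \<times> bool list \<times> (nat \<Rightarrow> int)" where
  "bit_step \<rho> (k, buf, v) b =
     (if m \<le> k then (Suc m, [], v)
      else if Suc (length buf) = L then (Suc k, [], accumulate v (\<beta> \<rho> k (buf @ [b])))
      else (k, buf @ [b], v))"

definition states :: "(nat \<times> bool list \<times> (nat \<Rightarrow> int)) set" where
  "states = {..Suc m} \<times> {bs. length bs < L} \<times> ({..<d} \<rightarrow>\<^sub>E {0..<int p})"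

lemma start_in_states: "start \<in> states"
  using L p by (auto simp: start_def states_def)

lemma accumulate_accumulate: "accumulate (accumulate v a) b = accumulate v (\<lambda>c. a c + b c)"
  by (auto simp: accumulate_def fun_eq_iff mod_simps add.assoc)

lemma accumulate_in: "accumulate v a \<in> {..<d} \<rightarrow>\<^sub>E {0..<int p}"
  using p by (auto simp: accumulate_def)

lemma token_step_in_states: "q \<in> states \<Longrightarrow> token_step \<rho> q e \<in> states"
  by (cases q) (auto simp: states_def intro: accumulate_in[THEN PiE_mem] accumulate_in[THEN PiE_arb] accumulate_in)

lemma bit_step_in_states: "q \<in> states \<Longrightarrow> bit_step \<rho> q b \<in> states"
  using L by (cases q) (auto simp: states_def accumulate_in)

lemma card_states_le:
  assumes "m + 2 \<le> 2 ^ a" "p \<le> 2 ^ r"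
  shows "finite states" "card states \<le> 2 ^ (a + L + r * d)"
proof -
  have eq: "{bs :: bool list. length bs < L} = {bs. set bs \<subseteq> UNIV \<and> length bs \<le> L - 1}" using L by auto
  have fin: "finite {bs :: bool list. length bs < L}" unfolding eq by (intro finite_lists_length_le) auto
  have "card {bs :: bool list. length bs < L} = (\<Sum>i\<le>L - 1. 2 ^ i)"
    unfolding eq by (subst card_lists_length_le) auto
  also have "(\<Sum>i\<le>K. 2 ^ i) \<le> (2::nat) ^ (K + 1)" for K by (induction K) auto
  then have "(\<Sum>i\<le>L - 1. 2 ^ i) \<le> (2::nat) ^ L" using L by (metis Suc_eq_plus1 Suc_pred')
  finally have c: "card {bs :: bool list. length bs < L} \<le> 2 ^ L" .
  show "finite states" unfolding states_def using fin by (intro finite_SigmaI finite_PiE) auto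
  have "card states = (m + 2) * (card {bs :: bool list. length bs < L} * p ^ d)"
    by (simp add: states_def card_cartesian_product card_funcsetE)
  also have "\<dots> \<le> 2 ^ a * (2 ^ L * (2 ^ r) ^ d)" using assms c by (intro mult_le_mono power_mono) auto
  also have "\<dots> = 2 ^ (a + L + r * d)" by (simp add: power_add power_mult)
  finally show "card states \<le> 2 ^ (a + L + r * d)" .
qed

lemma foldl_token_step:
  assumes "v \<in> {..<d} \<rightarrow>\<^sub>E {0..<int p}"
  shows "foldl (token_step \<rho>) (k, buf, v) \<sigma> = (k, buf, accumulate v (\<lambda>c. \<Sum>e\<leftarrow>\<sigma>. \<alpha> \<rho> e c))"
  using assms
proof (induction \<sigma> arbitrary: v)
  case Nil
  then show ?case by (force simp: accumulate_def fun_eq_iff PiE_iff extensional_def)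
next
  case (Cons e \<sigma>)
  show ?case
    using Cons.IH[OF accumulate_in] by (simp add: accumulate_accumulate)
qed

lemma block_append: "Suc k * L \<le> length w \<Longrightarrow> block L (w @ w') k = block L w k"
  by (auto simp: block_def)

text \<open>The counter holds the number of complete blocks and the buffer the remainder. In the
  sink the sketch has no bearing on the verdict, so there it is only named, by the fold
  itself.\<close>

lemma foldl_bit_step:
  assumes v: "v \<in> {..<d} \<rightarrow>\<^sub>E {0..<int p}"
  shows "foldl (bit_step \<rho>) (0, [], v) w =
    (if length w \<le> m * L
     then (length w div L, drop (length w div L * L) w,
       accumulate v (\<lambda>c. \<Sum>k<length w div L. \<beta> \<rho> k (block L w k) c))
     else (Suc m, [], snd (snd (foldl (bit_step \<rho>) (0, [], v) w))))"
proof (induction w rule: rev_induct)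
  case Nil
  then show ?case using v by (force simp: accumulate_def fun_eq_iff PiE_iff extensional_def)
next
  case (snoc b w)
  define k where "k = length w div L"
  have lk: "k * L \<le> length w" "length w < Suc k * L"
    using L by (simp_all add: k_def div_mult_mod_eq dividend_less_div_times add.commute)
  consider "length w > m * L" | "length w = m * L" | "length w < m * L" by linarith
  then show ?case
  proof cases
    case 1
    then show ?thesis using snoc by (cases "foldl (bit_step \<rho>) (0, [], v) w") auto
  next
    case 2
    then show ?thesis using snoc L by simp
  next
    case 3
    then have "k < m" using lk by (meson le_less_trans mult_less_cancel2)
    have fold: "foldl (bit_step \<rho>) (0, [], v) w =
        (k, drop (k * L) w, accumulate v (\<lambda>c. \<Sum>i<k. \<beta> \<rho> i (block L w i) c))"
      using snoc 3 by (simp add: k_def)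
    have pre: "(\<Sum>i<k. \<beta> \<rho> i (block L w i) c) = (\<Sum>i<k. \<beta> \<rho> i (block L (w @ [b]) i) c)" for c
    proof (intro sum.cong refl)
      fix i assume "i \<in> {..<k}"
      then have "Suc i * L \<le> k * L" by (intro mult_le_mono1) auto
      then show "\<beta> \<rho> i (block L w i) c = \<beta> \<rho> i (block L (w @ [b]) i) c"
        using lk by (simp add: block_append)
    qed
    show ?thesis
    proof (cases "Suc (length w) = Suc k * L")
      case True
      have div: "length (w @ [b]) div L = Suc k" using True L by simp
      have len: "length (w @ [b]) \<le> m * L" using 3 by simp
      have bl: "block L (w @ [b]) k = drop (k * L) w @ [b]"
        using True lk L by (simp add: block_def)
      have "Suc (length (drop (k * L) w)) = L" using True lk by simp
      then have "foldl (bit_step \<rho>) (0, [], v) (w @ [b]) =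
         (Suc k, [], accumulate (accumulate v (\<lambda>c. \<Sum>i<k. \<beta> \<rho> i (block L w i) c)) (\<beta> \<rho> k (block L (w @ [b]) k)))"
        using fold \<open>k < m\<close> bl by simp
      also have "accumulate (accumulate v (\<lambda>c. \<Sum>i<k. \<beta> \<rho> i (block L w i) c)) (\<beta> \<rho> k (block L (w @ [b]) k)) =
          accumulate v (\<lambda>c. \<Sum>i<Suc k. \<beta> \<rho> i (block L (w @ [b]) i) c)"
        by (simp add: accumulate_accumulate pre)
      also have "(Suc k, [], \<dots>) = (length (w @ [b]) div L, drop (length (w @ [b]) div L * L) (w @ [b]), \<dots>)"
        using div True by simp
      finally show ?thesis using len div by simp
    next
      case False
      have div: "length (w @ [b]) div L = k"
        using False lk L by (intro div_nat_eqI) (auto simp: algebra_simps)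
      have len: "length (w @ [b]) \<le> m * L" using 3 by simp
      have "Suc (length (drop (k * L) w)) \<noteq> L" using False lk by auto
      then show ?thesis using fold \<open>k < m\<close> div len lk pre by simp
    qed
  qed
qed

text \<open>The states are numbered injectively below 2^S. Numbers that encode no state decode to
  \<open>start\<close>, so that the transitions respect the space bound on every number, as
  \<open>space_bounded\<close> demands.\<close>

lemma scheme_exists:
  assumes ma: "m + 2 \<le> 2 ^ a" and pr: "p \<le> 2 ^ r"
  shows "\<exists>P. rbits P = b \<and> prover P = pv \<and> space_bounded P (a + L + r * d) \<and>
    (\<forall>\<rho> \<sigma> w. run_scheme P \<rho> \<sigma> w =
      (if length w = m * L
       then out \<rho> (\<lambda>c\<in>{..<d}. ((\<Sum>e\<leftarrow>\<sigma>. \<alpha> \<rho> e c) + (\<Sum>k<m. \<beta> \<rho> k (block L w k) c)) mod int p)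
       else None))"
proof -
  define S where "S = a + L + r * d"
  have fin: "finite states" and "card states \<le> card {..<(2::nat) ^ S}"
    using card_states_le[OF ma pr] by (simp_all add: S_def)
  then obtain enc :: "nat \<times> bool list \<times> (nat \<Rightarrow> int) \<Rightarrow> nat"
    where enc: "enc ` states \<subseteq> {..<2 ^ S}" "inj_on enc states"
    using card_le_inj[OF fin finite_lessThan] by blast
  define dec where "dec x = (if x \<in> enc ` states then inv_into states enc x else start)" for x
  have dec_in: "dec x \<in> states" for x
    using start_in_states by (auto simp: dec_def intro: inv_into_into)
  have dec_enc: "dec (enc q) = q" if "q \<in> states" for q
    using that enc(2) by (simp add: dec_def)
  have enc_less: "enc q < 2 ^ S" if "q \<in> states" for q using enc(1) that by auto
  define final where "final \<rho> q = (if fst q = m \<and> fst (snd q) = [] then out \<rho> (snd (snd q)) else None)"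
    for \<rho> and q :: "nat \<times> bool list \<times> (nat \<Rightarrow> int)"
  define P where "P = \<lparr>rbits = b, vinit = (\<lambda>\<rho>. enc start),
    vstep = (\<lambda>\<rho> x e. enc (token_step \<rho> (dec x) e)),
    vhelp = (\<lambda>\<rho> x bt. enc (bit_step \<rho> (dec x) bt)),
    vout = (\<lambda>\<rho> x. final \<rho> (dec x)), prover = pv\<rparr>"
  have "space_bounded P S"
    by (simp add: space_bounded_def P_def enc_less start_in_states token_step_in_states bit_step_in_states dec_in)
  moreover have "run_scheme P \<rho> \<sigma> w =
      (if length w = m * L
       then out \<rho> (\<lambda>c\<in>{..<d}. ((\<Sum>e\<leftarrow>\<sigma>. \<alpha> \<rho> e c) + (\<Sum>k<m. \<beta> \<rho> k (block L w k) c)) mod int p)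
       else None)" for \<rho> \<sigma> w
  proof -
    have f1: "foldl (vstep P \<rho>) (enc q) \<sigma> = enc (foldl (token_step \<rho>) q \<sigma>) \<and> foldl (token_step \<rho>) q \<sigma> \<in> states"
      if "q \<in> states" for q
      using that by (induction \<sigma> arbitrary: q) (simp_all add: P_def dec_enc token_step_in_states)
    have f2: "foldl (vhelp P \<rho>) (enc q) w = enc (foldl (bit_step \<rho>) q w) \<and> foldl (bit_step \<rho>) q w \<in> states"
      if "q \<in> states" for q
      using that by (induction w arbitrary: q) (simp_all add: P_def dec_enc bit_step_in_states)
    define v where "v = accumulate (\<lambda>c\<in>{..<d}. 0) (\<lambda>c. \<Sum>e\<leftarrow>\<sigma>. \<alpha> \<rho> e c)"
    have v: "v \<in> {..<d} \<rightarrow>\<^sub>E {0..<int p}" unfolding v_def by (rule accumulate_in)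
    have "foldl (token_step \<rho>) start \<sigma> = (0, [], v)"
      unfolding start_def v_def using p by (intro foldl_token_step) auto
    then have "run_scheme P \<rho> \<sigma> w = final \<rho> (foldl (bit_step \<rho>) (0, [], v) w)"
      using f1[OF start_in_states] f2 dec_enc by (simp add: run_scheme_def P_def)
    also have "\<dots> = (if length w = m * L then out \<rho> (accumulate v (\<lambda>c. \<Sum>k<m. \<beta> \<rho> k (block L w k) c)) else None)"
    proof (cases "length w \<le> m * L")
      case True
      then have "length w div L = m \<and> drop (length w div L * L) w = [] \<longleftrightarrow> length w = m * L"
        using L by (auto intro!: le_antisym)
      then show ?thesis using True L by (subst foldl_bit_step[OF v]) (auto simp: final_def)
    next
      case False
      then show ?thesis by (subst foldl_bit_step[OF v]) (auto simp: final_def)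
    qed
    also have "accumulate v (\<lambda>c. \<Sum>k<m. \<beta> \<rho> k (block L w k) c) =
       (\<lambda>c\<in>{..<d}. ((\<Sum>e\<leftarrow>\<sigma>. \<alpha> \<rho> e c) + (\<Sum>k<m. \<beta> \<rho> k (block L w k) c)) mod int p)"
      by (auto simp: v_def accumulate_def fun_eq_iff mod_simps)
    finally show ?thesis .
  qed
  moreover have "rbits P = b" "prover P = pv" by (simp_all add: P_def)
  ultimately show ?thesis unfolding S_def by blast
qed

end

section \<open>Verifying local conditions and a bilinear sum on vertex labels\<close>

lemma sum_lessThan_mult:
  fixes f :: "nat \<Rightarrow> 'a::comm_monoid_add"
  shows "(\<Sum>e<a * b. f e) = (\<Sum>k<a. \<Sum>j<b. f (k * b + j))"
proof -
  have "sum f {k * b..<k * b + b} = (\<Sum>j<b. f (k * b + j))" for k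
    using sum.shift_bounds_nat_ivl[of f 0 "k * b" b] by (simp add: atLeast0LessThan add.commute)
  then show ?thesis by (simp flip: sum.nat_group)
qed

lemma dvd_diff_imp_eq: "a < p \<Longrightarrow> b < p \<Longrightarrow> int p dvd int a - int b \<Longrightarrow> a = b"
  by (metis mod_eq_dvd_iff mod_less of_nat_eq_iff zmod_int)

lemma coeff_sum_monom_lessThan: "coeff (\<Sum>e<N. monom (c e) e) i = (if i < N then c i else 0)"
  by (simp add: coeff_sum)

lemma degree_sum_monom_le: "degree (\<Sum>e<N. monom (c e) e) \<le> N"
  by (intro degree_sum_le) (auto intro: order_trans[OF degree_monom_le])

lemma block_concat:
  assumes "\<And>xs. xs \<in> set xss \<Longrightarrow> length xs = L" "k < length xss"
  shows "block L (concat xss) k = xss ! k"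
  using assms
proof (induction xss arbitrary: k)
  case (Cons xs xss)
  then show ?case by (cases k) (auto simp: block_def)
qed simp

text \<open>Every bit block decodes to entries below \<open>p\<close>, so a dishonest Prover cannot
  send numbers out of range, and congruence of entries modulo \<open>p\<close> is equality. Vectors
  are functions padded with zeros, which makes decoding an exact inverse.\<close>

definition codec :: "nat \<Rightarrow> nat \<Rightarrow> nat \<Rightarrow> ((nat \<Rightarrow> nat) \<Rightarrow> bool list) \<Rightarrow> (bool list \<Rightarrow> nat \<Rightarrow> nat) \<Rightarrow> bool" where
  "codec p a L enc dec \<longleftrightarrow> (\<forall>bl. \<forall>c<a. dec bl c < p) \<and> (\<forall>y. length (enc y) = L) \<and>
     (\<forall>y. (\<forall>c<a. y c < p) \<and> (\<forall>c\<ge>a. y c = 0) \<longrightarrow> dec (enc y) = y)"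

lemma codec_exists:
  assumes "p > 0" "p \<le> 2 ^ q"
  shows "\<exists>enc dec. codec p a (q * a) enc dec"
proof -
  define A where "A = ({..<a} \<rightarrow>\<^sub>E {..<p})"
  define B where "B = {bl :: bool list. length bl = q * a}"
  have fA: "finite A" unfolding A_def by (intro finite_PiE) auto
  have fB: "finite B" and cB: "card B = 2 ^ (q * a)"
    using finite_lists_length_eq[of "UNIV :: bool set" "q * a"] card_lists_length_eq[of "UNIV :: bool set" "q * a"]
    by (simp_all add: B_def)
  have "card A = p ^ a" by (simp add: A_def card_funcsetE)
  also have "\<dots> \<le> (2 ^ q) ^ a" using assms by (intro power_mono) auto
  also have "\<dots> = card B" by (simp add: cB power_mult)
  finally obtain g where g: "g ` A \<subseteq> B" "inj_on g A" using card_le_inj[OF fA fB] by blast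
  define z where "z = (\<lambda>c\<in>{..<a}. 0 :: nat)"
  have z: "z \<in> A" using assms by (auto simp: A_def z_def)
  define dec0 where "dec0 bl = (if bl \<in> g ` A then inv_into A g bl else z)" for bl
  define dec where "dec bl c = (if c < a then dec0 bl c else 0)" for bl c
  define enc where "enc y = (let y' = restrict y {..<a} in if y' \<in> A then g y' else g z)" for y
  have "dec bl c < p" if "c < a" for bl c
  proof -
    have "dec0 bl \<in> A" using z by (auto simp: dec0_def intro: inv_into_into)
    then show ?thesis using that by (auto simp: A_def dec_def)
  qed
  moreover have "length (enc y) = q * a" for y
  proof -
    have "enc y \<in> g ` A" using z by (auto simp: enc_def Let_def)
    then show ?thesis using g by (auto simp: B_def)
  qed
  moreover have "dec (enc y) = y" if y: "\<forall>c<a. y c < p" "\<forall>c\<ge>a. y c = 0" for y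
  proof -
    have "restrict y {..<a} \<in> A" using y(1) by (auto simp: A_def)
    then have "dec0 (enc y) = restrict y {..<a}" using g by (simp add: enc_def dec0_def)
    then show ?thesis using y(2) by (auto simp: fun_eq_iff dec_def)
  qed
  ultimately have "codec p a (q * a) enc dec" by (simp add: codec_def)
  then show ?thesis by blast
qed

text \<open>Help symbol \<open>k = i * t + i'\<close> is a vector \<open>y\<close> of \<open>4 * s\<close> numbers below \<open>p\<close>: the labels of chunk \<open>i\<close>
  (entries \<open>0..<s\<close>), the labels of chunk \<open>i'\<close> (entries \<open>s..<2 * s\<close>), and the \<open>2 * s\<close> coefficients
  of the sum-check polynomial at \<open>k * (2 * s)\<close> and above. The copies with \<open>i' = 0\<close> in the first half
  define the labelling \<open>lab\<close>; \<open>refk\<close> and \<open>refc\<close> locate the entry of \<open>lab\<close> that the copy number \<open>e\<close> has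
  to agree with, so that \<open>Ftot\<close> vanishes modulo \<open>p\<close> iff all copies agree with \<open>lab\<close>.\<close>

locale label_protocol =
  fixes n t s p :: nat
    and W :: "nat \<Rightarrow> nat \<Rightarrow> nat \<Rightarrow> nat \<Rightarrow> nat"
    and \<phi> :: "nat \<Rightarrow> nat \<Rightarrow> nat \<Rightarrow> nat \<Rightarrow> bool"
    and \<tau> :: "nat \<Rightarrow> nat \<Rightarrow> nat"
  assumes ts: "t * s = n" and t0: "t > 0" and s0: "s > 0" and p: "prime p"
    and W_le: "\<And>u a v b. W u a v b \<le> n + 2" and \<tau>_le: "\<And>v a. \<tau> v a \<le> 1"
    and p_large: "n * n * (n + 2) < p" "n < p"
begin

definition certifies :: "(nat \<Rightarrow> nat) \<Rightarrow> (nat \<times> nat) list \<Rightarrow> bool" where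
  "certifies \<l> \<sigma> \<longleftrightarrow> (\<forall>u<n. \<forall>v<n. \<phi> u (\<l> u) v (\<l> v)) \<and>
     (\<Sum>(u, v)\<in>set \<sigma>. W u (\<l> u) v (\<l> v)) = (\<Sum>v<n. \<tau> v (\<l> v))"

text \<open>Each of the t^2 help symbols carries 2s label copies and 2s sum-check coefficients, so
  \<open>N\<close> counts both; it also bounds the degrees of the tested polynomials.\<close>

definition N :: nat where "N = t * t * (2 * s)"

definition Apoly :: "nat \<times> nat \<Rightarrow> nat \<Rightarrow> int poly" where
  "Apoly e j = (if snd e mod s = j then monom 1 (fst e * t + snd e div s) else 0)"

text \<open>The exponents are reversed with respect to \<open>Apoly\<close>: the monomial of an edge
  (u, v) lifts a term to exponent \<open>n * t\<close> exactly when that term belongs to u and to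
  the chunk of v.\<close>

definition Zpoly :: "nat \<Rightarrow> (nat \<Rightarrow> nat) \<Rightarrow> nat \<Rightarrow> int poly" where
  "Zpoly k y j = (\<Sum>j'<s. monom (int (W (k mod t * s + j') (y (s + j')) (k div t * s + j) (y j)))
     (n * t - ((k mod t * s + j') * t + k div t)))"

definition refk :: "nat \<Rightarrow> nat" where
  "refk e = (if e mod (2 * s) < s then e div (2 * s) div t else e div (2 * s) mod t) * t"

definition refc :: "nat \<Rightarrow> nat" where "refc e = e mod (2 * s) mod s"

text \<open>The copies sent in symbol \<open>k\<close>, minus the entries of symbol \<open>k\<close>
  at all positions that refer to it. A copy and its reference may sit in different symbols; this
  splitting lets each symbol be processed by itself.\<close>

definition Fpoly :: "nat \<Rightarrow> (nat \<Rightarrow> nat) \<Rightarrow> int poly" where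
  "Fpoly k y = (\<Sum>c<2 * s. monom (int (y c)) (k * (2 * s) + c)) -
     (\<Sum>e<N. if refk e = k then monom (int (y (refc e))) e else 0)"

definition Gpoly :: "nat \<Rightarrow> (nat \<Rightarrow> nat) \<Rightarrow> int poly" where
  "Gpoly k y = (\<Sum>c<2 * s. monom (int (y (2 * s + c))) (k * (2 * s) + c))"

definition viol :: "nat \<Rightarrow> (nat \<Rightarrow> nat) \<Rightarrow> nat" where
  "viol k y = (\<Sum>j<s. \<Sum>j'<s.
     if \<phi> (k mod t * s + j') (y (s + j')) (k div t * s + j) (y j) then 0 else 1)"

definition tauk :: "nat \<Rightarrow> (nat \<Rightarrow> nat) \<Rightarrow> nat" where
  "tauk k y = (if k mod t = 0 then \<Sum>j<s. \<tau> (k div t * s + j) (y j) else 0)"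

definition Atot :: "(nat \<times> nat) list \<Rightarrow> nat \<Rightarrow> int poly" where
  "Atot \<sigma> j = (\<Sum>e\<in>set \<sigma>. Apoly e j)"

definition Ztot :: "(nat \<Rightarrow> nat \<Rightarrow> nat) \<Rightarrow> nat \<Rightarrow> int poly" where
  "Ztot x j = (\<Sum>k<t * t. Zpoly k (x k) j)"

definition Ftot :: "(nat \<Rightarrow> nat \<Rightarrow> nat) \<Rightarrow> int poly" where
  "Ftot x = (\<Sum>k<t * t. Fpoly k (x k))"

definition Gtot :: "(nat \<Rightarrow> nat \<Rightarrow> nat) \<Rightarrow> int poly" where
  "Gtot x = (\<Sum>k<t * t. Gpoly k (x k))"

definition Htot :: "(nat \<times> nat) list \<Rightarrow> (nat \<Rightarrow> nat \<Rightarrow> nat) \<Rightarrow> int poly" where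
  "Htot \<sigma> x = Gtot x - (\<Sum>j<s. Atot \<sigma> j * Ztot x j)"

definition lab :: "(nat \<Rightarrow> nat \<Rightarrow> nat) \<Rightarrow> nat \<Rightarrow> nat" where
  "lab x v = x (v div s * t) (v mod s)"

definition consistent :: "(nat \<Rightarrow> nat \<Rightarrow> nat) \<Rightarrow> bool" where
  "consistent x \<longleftrightarrow> (\<forall>i<t. \<forall>i'<t. \<forall>j<s.
     x (i * t + i') j = lab x (i * s + j) \<and> x (i * t + i') (s + j) = lab x (i' * s + j))"

definition accepts :: "int \<Rightarrow> (nat \<times> nat) list \<Rightarrow> (nat \<Rightarrow> nat \<Rightarrow> nat) \<Rightarrow> bool" where
  "accepts r \<sigma> x \<longleftrightarrow> int p dvd poly (Ftot x) r \<and> int p dvd int (\<Sum>k<t * t. viol k (x k)) \<and>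
     int p dvd poly (Htot \<sigma> x) r \<and>
     int p dvd coeff (Gtot x) (n * t) - int (\<Sum>k<t * t. tauk k (x k))"

section \<open>The totals over all help symbols, expressed through the labelling\<close>

lemma N_eq: "N = 2 * n * t" using ts by (simp add: N_def algebra_simps)

lemma block_index: "i < t \<Longrightarrow> j < s \<Longrightarrow> i * s + j < n"
proof -
  assume "i < t" "j < s"
  then have "i * s + j < Suc i * s" by simp
  also have "\<dots> \<le> t * s" using \<open>i < t\<close> by (intro mult_le_mono1) simp
  finally show ?thesis by (simp add: ts)
qed

lemma pair_index: "i < t \<Longrightarrow> i' < t \<Longrightarrow> i * t + i' < t * t"
proof -
  assume "i < t" "i' < t"
  then have "i * t + i' < Suc i * t" by simp
  also have "\<dots> \<le> t * t" using \<open>i < t\<close> by (intro mult_le_mono1) simp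
  finally show ?thesis .
qed

lemma refk_less: "e < N \<Longrightarrow> refk e < t * t"
proof -
  assume "e < N"
  then have "e div (2 * s) < t * t" by (simp add: N_def less_mult_imp_div_less)
  then have "e div (2 * s) div t < t" by (simp add: less_mult_imp_div_less)
  then show ?thesis using t0 by (simp add: refk_def)
qed

lemma Ftot_eq: "Ftot x = (\<Sum>e<N. monom (int (x (e div (2 * s)) (e mod (2 * s))) - int (x (refk e) (refc e))) e)"
proof -
  have "(\<Sum>k<t * t. \<Sum>e<N. if refk e = k then monom (int (x k (refc e))) e else 0) =
      (\<Sum>e<N. \<Sum>k<t * t. if refk e = k then monom (int (x k (refc e))) e else 0)"
    by (rule sum.swap)
  also have "\<dots> = (\<Sum>e<N. monom (int (x (refk e) (refc e))) e)"
    by (intro sum.cong refl) (simp add: refk_less)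
  finally have 1: "(\<Sum>k<t * t. \<Sum>e<N. if refk e = k then monom (int (x k (refc e))) e else 0) =
    (\<Sum>e<N. monom (int (x (refk e) (refc e))) e)" .
  have 2: "(\<Sum>k<t * t. \<Sum>c<2 * s. monom (int (x k c)) (k * (2 * s) + c)) =
      (\<Sum>e<N. monom (int (x (e div (2 * s)) (e mod (2 * s)))) e)"
    unfolding N_def sum_lessThan_mult[of _ "t * t" "2 * s"] by simp
  show ?thesis by (simp only: Ftot_def Fpoly_def sum_subtractf 1 2 diff_monom[symmetric])
qed

lemma coeff_Ftot:
  "e < N \<Longrightarrow> coeff (Ftot x) e = int (x (e div (2 * s)) (e mod (2 * s))) - int (x (refk e) (refc e))"
  unfolding Ftot_eq coeff_sum_monom_lessThan by simp

lemma Gtot_eq: "Gtot x = (\<Sum>e<N. monom (int (x (e div (2 * s)) (2 * s + e mod (2 * s)))) e)"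
  unfolding Gtot_def Gpoly_def N_def sum_lessThan_mult[of _ "t * t" "2 * s"] by simp

text \<open>The coefficient at \<open>e\<close> is a copy minus its reference entry; as both lie
  below \<open>p\<close>, divisibility forces equality.\<close>

lemma consistentI:
  assumes x: "\<And>k c. k < t * t \<Longrightarrow> c < 4 * s \<Longrightarrow> x k c < p" and F: "\<And>e. int p dvd coeff (Ftot x) e"
  shows "consistent x"
proof -
  have eq: "x (e div (2 * s)) (e mod (2 * s)) = x (refk e) (refc e)" if e: "e < N" for e
  proof -
    have "e div (2 * s) < t * t" using e by (simp add: N_def less_mult_imp_div_less)
    moreover have "e mod (2 * s) < 4 * s" using s0 mod_less_divisor[of "2 * s" e] by linarith
    moreover have "refc e < s" using s0 by (simp add: refc_def)
    then have "refc e < 4 * s" by linarith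
    ultimately have "x (e div (2 * s)) (e mod (2 * s)) < p" "x (refk e) (refc e) < p"
      using x refk_less[OF e] by auto
    moreover have "int p dvd int (x (e div (2 * s)) (e mod (2 * s))) - int (x (refk e) (refc e))"
      using F[of e] e by (simp add: coeff_Ftot)
    ultimately show ?thesis by (rule dvd_diff_imp_eq)
  qed
  show ?thesis unfolding consistent_def
  proof (intro allI impI conjI)
    fix i i' j assume h: "i < t" "i' < t" "j < s"
    define k where "k = i * t + i'"
    have k: "k < t * t" "k div t = i" "k mod t = i'" using h pair_index by (simp_all add: k_def)
    have N: "k * (2 * s) + c < N" if "c < 2 * s" for c
    proof -
      have "k * (2 * s) + c < Suc k * (2 * s)" using that by simp
      also have "\<dots> \<le> t * t * (2 * s)" using k(1) by (intro mult_le_mono1) simp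
      finally show ?thesis by (simp add: N_def)
    qed
    show "x (i * t + i') j = lab x (i * s + j)"
      using eq[OF N[of j]] h k by (simp add: refk_def refc_def lab_def k_def)
    show "x (i * t + i') (s + j) = lab x (i' * s + j)"
      using eq[OF N[of "s + j"]] h k by (simp add: refk_def refc_def lab_def k_def)
  qed
qed

lemma consistentD:
  assumes "consistent x" "i < t" "i' < t" "j < s"
  shows "x (i * t + i') j = lab x (i * s + j)" "x (i * t + i') (s + j) = lab x (i' * s + j)"
  using assms unfolding consistent_def by blast+

lemma sum_tauk:
  "(\<Sum>k<t * t. tauk k (x k)) = (\<Sum>v<n. \<tau> v (lab x v))"
proof -
  have "(\<Sum>k<t * t. tauk k (x k)) = (\<Sum>i<t. \<Sum>i'<t. tauk (i * t + i') (x (i * t + i')))"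
    by (rule sum_lessThan_mult)
  also have "\<dots> = (\<Sum>i<t. \<Sum>i'<t. if i' = 0 then \<Sum>j<s. \<tau> (i * s + j) (x (i * t) j) else 0)"
    by (intro sum.cong refl) (auto simp: tauk_def)
  also have "\<dots> = (\<Sum>i<t. \<Sum>j<s. \<tau> (i * s + j) (x (i * t) j))"
    by (rule sum.cong[OF refl]) (use t0 in simp)
  also have "\<dots> = (\<Sum>i<t. \<Sum>j<s. \<tau> (i * s + j) (lab x (i * s + j)))"
    by (intro sum.cong refl) (simp add: lab_def)
  also have "\<dots> = (\<Sum>v<n. \<tau> v (lab x v))"
    unfolding ts[symmetric] by (rule sum_lessThan_mult[symmetric])
  finally show ?thesis .
qed

lemma sum_viol:
  assumes "consistent x"
  shows "(\<Sum>k<t * t. viol k (x k)) = (\<Sum>v<n. \<Sum>u<n. if \<phi> u (lab x u) v (lab x v) then 0 else 1)"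
proof -
  have "(\<Sum>k<t * t. viol k (x k)) = (\<Sum>i<t. \<Sum>i'<t. viol (i * t + i') (x (i * t + i')))"
    by (rule sum_lessThan_mult)
  also have "\<dots> = (\<Sum>i<t. \<Sum>i'<t. \<Sum>j<s. \<Sum>j'<s.
      if \<phi> (i' * s + j') (lab x (i' * s + j')) (i * s + j) (lab x (i * s + j)) then 0 else 1)"
    by (intro sum.cong refl) (simp add: viol_def consistentD[OF assms])
  also have "\<dots> = (\<Sum>i<t. \<Sum>j<s. \<Sum>i'<t. \<Sum>j'<s.
      if \<phi> (i' * s + j') (lab x (i' * s + j')) (i * s + j) (lab x (i * s + j)) then 0 else 1)"
    by (rule sum.cong[OF refl], rule sum.swap)
  also have "\<dots> = (\<Sum>v<n. \<Sum>u<n. if \<phi> u (lab x u) v (lab x v) then 0 else 1)"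
    unfolding ts[symmetric] by (simp only: sum_lessThan_mult)
  finally show ?thesis .
qed

lemma Ztot_eq:
  assumes "consistent x" "j < s"
  shows "Ztot x j = (\<Sum>i<t. \<Sum>u<n. monom (int (W u (lab x u) (i * s + j) (lab x (i * s + j)))) (n * t - (u * t + i)))"
proof -
  have "Ztot x j = (\<Sum>i<t. \<Sum>i'<t. Zpoly (i * t + i') (x (i * t + i')) j)"
    unfolding Ztot_def by (rule sum_lessThan_mult)
  also have "\<dots> = (\<Sum>i<t. \<Sum>i'<t. \<Sum>j'<s.
     monom (int (W (i' * s + j') (lab x (i' * s + j')) (i * s + j) (lab x (i * s + j))))
      (n * t - ((i' * s + j') * t + i)))"
    using assms(2) by (intro sum.cong refl) (simp add: Zpoly_def consistentD[OF assms(1)])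
  also have "\<dots> = (\<Sum>i<t. \<Sum>u<n. monom (int (W u (lab x u) (i * s + j) (lab x (i * s + j)))) (n * t - (u * t + i)))"
    unfolding ts[symmetric] by (simp only: sum_lessThan_mult)
  finally show ?thesis .
qed

text \<open>By linearity one edge (u, v) suffices. It contributes only for j = v mod s, with
  exponent u t + v div s, from which u and the chunk of v can be recovered because v div s < t.
  Hence exactly one term of \<open>Ztot\<close> lands on \<open>n * t\<close>, namely the weight of
  (u, v).\<close>

lemma coeff_cross:
  assumes \<sigma>: "valid_stream n \<sigma>" and x: "consistent x"
  shows "coeff (\<Sum>j<s. Atot \<sigma> j * Ztot x j) (n * t) =
    int (\<Sum>(u, v)\<in>set \<sigma>. W u (lab x u) v (lab x v))"
proof -
  have edge: "coeff (\<Sum>j<s. Apoly (u, v) j * Ztot x j) (n * t) = int (W u (lab x u) v (lab x v))"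
    if uv: "(u, v) \<in> set \<sigma>" for u v
  proof -
    have u: "u < n" and v: "v < n" using uv \<sigma> by (auto simp: valid_stream_def)
    define j where "j = v mod s"
    define i where "i = v div s"
    have i: "i < t" using v unfolding i_def ts[symmetric] by (rule less_mult_imp_div_less)
    have j: "j < s" using s0 by (simp add: j_def)
    \<comment> \<open>All exponents stay below \<open>n * t\<close>, so the truncated subtraction in
      \<open>Zpoly\<close> is exact and keeps distinct exponents distinct.\<close>
    have lt: "u' * t + i' < n * t" if "u' < n" "i' < t" for u' i'
    proof -
      have "u' * t + i' < Suc u' * t" using that by simp
      also have "\<dots> \<le> n * t" using that by (intro mult_le_mono1) simp
      finally show ?thesis .
    qed
    have inj: "u' * t + i' = u * t + i \<longleftrightarrow> i' = i \<and> u' = u" if "i' < t" for u' i'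
      using that i by (metis div_mult_self3 div_less add.commute add_cancel_left_left mod_mult_self3 mod_less less_nat_zero_code)
    have "(\<Sum>j<s. Apoly (u, v) j * Ztot x j) = monom 1 (u * t + i) * Ztot x j"
    proof -
      have "(\<Sum>j'<s. Apoly (u, v) j' * Ztot x j') = (\<Sum>j'<s. if j = j' then monom 1 (u * t + i) * Ztot x j' else 0)"
        by (intro sum.cong refl) (simp add: Apoly_def i_def j_def)
      then show ?thesis using j by simp
    qed
    then have "coeff (\<Sum>j<s. Apoly (u, v) j * Ztot x j) (n * t) = coeff (Ztot x j) (n * t - (u * t + i))"
      using lt[OF u i] by (simp add: coeff_monom_mult)
    also have "\<dots> = (\<Sum>i'<t. \<Sum>u'<n. if n * t - (u' * t + i') = n * t - (u * t + i)
        then int (W u' (lab x u') (i' * s + j) (lab x (i' * s + j))) else 0)"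
      by (simp add: Ztot_eq[OF x j] coeff_sum)
    also have "\<dots> = (\<Sum>i'<t. \<Sum>u'<n. if i' = i then if u' = u
        then int (W u (lab x u) (i * s + j) (lab x (i * s + j))) else 0 else 0)"
    proof (intro sum.cong refl)
      fix i' u' assume "i' \<in> {..<t}" "u' \<in> {..<n}"
      then have "n * t - (u' * t + i') = n * t - (u * t + i) \<longleftrightarrow> i' = i \<and> u' = u"
        using lt[OF u i] lt[of u' i'] inj[of i' u'] by auto
      then show "(if n * t - (u' * t + i') = n * t - (u * t + i)
        then int (W u' (lab x u') (i' * s + j) (lab x (i' * s + j))) else 0) =
        (if i' = i then if u' = u
        then int (W u (lab x u) (i * s + j) (lab x (i * s + j))) else 0 else 0)" by simp
    qed
    also have "\<dots> = (\<Sum>i'<t. if i' = i then int (W u (lab x u) (i * s + j) (lab x (i * s + j))) else 0)"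
      using u by (intro sum.cong refl) auto
    also have "\<dots> = int (W u (lab x u) (i * s + j) (lab x (i * s + j)))" using i by simp
    finally show ?thesis by (simp add: i_def j_def)
  qed
  have "(\<Sum>j<s. Atot \<sigma> j * Ztot x j) = (\<Sum>e\<in>set \<sigma>. \<Sum>j<s. Apoly e j * Ztot x j)"
    unfolding Atot_def sum_distrib_right by (rule sum.swap)
  then have "coeff (\<Sum>j<s. Atot \<sigma> j * Ztot x j) (n * t) = (\<Sum>e\<in>set \<sigma>. coeff (\<Sum>j<s. Apoly e j * Ztot x j) (n * t))"
    by (simp add: coeff_sum)
  also have "\<dots> = (\<Sum>e\<in>set \<sigma>. int (case e of (u, v) \<Rightarrow> W u (lab x u) v (lab x v)))"
    by (intro sum.cong refl) (use edge in auto)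
  finally show ?thesis by simp
qed

section \<open>Degree bounds and soundness of the protocol\<close>

lemma degree_Ftot: "degree (Ftot x) \<le> N"
  unfolding Ftot_eq by (rule degree_sum_monom_le)

text \<open>The factors have degrees at most n t - 1 and n t, so the \<open>N\<close> = 2 n t
  coefficients sent by the Prover can describe the whole product.\<close>

lemma degree_cross_less:
  assumes "valid_stream n \<sigma>"
  shows "degree (\<Sum>j<s. Atot \<sigma> j * Ztot x j) < N"
proof -
  have A: "degree (Atot \<sigma> j) \<le> n * t - 1" for j unfolding Atot_def
  proof (rule degree_sum_le)
    fix e assume "e \<in> set \<sigma>"
    then have e: "fst e < n" "snd e < n" using assms by (auto simp: valid_stream_def)
    then have "snd e div s < t" unfolding ts[symmetric] by (intro less_mult_imp_div_less)
    then have "fst e * t + snd e div s < Suc (fst e) * t" by simp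
    also have "\<dots> \<le> n * t" using e by (intro mult_le_mono1) simp
    finally have "fst e * t + snd e div s \<le> n * t - 1" by simp
    then show "degree (Apoly e j) \<le> n * t - 1"
      by (auto simp: Apoly_def intro: order_trans[OF degree_monom_le])
  qed simp
  have Z: "degree (Ztot x j) \<le> n * t" for j unfolding Ztot_def Zpoly_def
    by (intro degree_sum_le) (auto intro!: order_trans[OF degree_monom_le])
  have "n * t > 0" using ts t0 s0 by auto
  then have "degree (Atot \<sigma> j * Ztot x j) \<le> N - 1" for j
    using degree_mult_le[of "Atot \<sigma> j" "Ztot x j"] A[of j] Z[of j] unfolding N_eq by linarith
  then have "degree (\<Sum>j<s. Atot \<sigma> j * Ztot x j) \<le> N - 1" by (intro degree_sum_le) auto
  moreover have "N > 0" using s0 t0 by (simp add: N_def)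
  ultimately show ?thesis by linarith
qed

lemma degree_Htot: "valid_stream n \<sigma> \<Longrightarrow> degree (Htot \<sigma> x) \<le> N"
  unfolding Htot_def Gtot_eq
  by (intro degree_diff_le degree_sum_monom_le less_imp_le degree_cross_less)

lemma sum_W_less:
  assumes "valid_stream n \<sigma>"
  shows "(\<Sum>(u, v)\<in>set \<sigma>. W u (\<l> u) v (\<l> v)) < p"
proof -
  have "(\<Sum>(u, v)\<in>set \<sigma>. W u (\<l> u) v (\<l> v)) \<le> (\<Sum>e\<in>set \<sigma>. n + 2)"
    using W_le by (intro sum_mono) (auto simp: case_prod_beta)
  also have "\<dots> = card (set \<sigma>) * (n + 2)" by simp
  also have "set \<sigma> \<subseteq> {..<n} \<times> {..<n}" using assms by (auto simp: valid_stream_def)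
  then have "card (set \<sigma>) \<le> card ({..<n} \<times> {..<n})" by (intro card_mono) auto
  then have "card (set \<sigma>) * (n + 2) \<le> n * n * (n + 2)" by (intro mult_le_mono1) simp
  also have "\<dots> < p" by (rule p_large)
  finally show ?thesis .
qed

lemma sum_\<tau>_less: "(\<Sum>v<n. \<tau> v (\<l> v)) < p"
proof -
  have "(\<Sum>v<n. \<tau> v (\<l> v)) \<le> (\<Sum>v<n. 1)" using \<tau>_le by (intro sum_mono) auto
  then show ?thesis using p_large by simp
qed

text \<open>Once both polynomial identities hold modulo \<open>p\<close>, the remaining tests
  concern integers below \<open>p\<close> (violations, total weight, total count), for which
  congruence means equality.\<close>

lemma accepts_imp_certifies:
  assumes \<sigma>: "valid_stream n \<sigma>"
    and x: "\<And>k c. k < t * t \<Longrightarrow> c < 4 * s \<Longrightarrow> x k c < p"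
    and F: "\<And>e. int p dvd coeff (Ftot x) e" and H: "\<And>e. int p dvd coeff (Htot \<sigma> x) e"
    and acc: "accepts r \<sigma> x"
  shows "certifies (lab x) \<sigma>"
proof -
  have c: "consistent x" using x F by (rule consistentI)
  define V where "V = (\<Sum>v<n. \<Sum>u<n. if \<phi> u (lab x u) v (lab x v) then 0 else (1::nat))"
  have "V \<le> (\<Sum>v<n. \<Sum>u<n. 1)" unfolding V_def by (intro sum_mono) auto
  also have "\<dots> \<le> n * n * (n + 2)" by simp
  finally have "V < p" using p_large by simp
  moreover have "int p dvd int V" using acc by (simp only: accepts_def sum_viol[OF c] V_def)
  ultimately have "V = 0" by (metis int_dvd_int_iff nat_dvd_not_less neq0_conv)
  then have "\<forall>u<n. \<forall>v<n. \<phi> u (lab x u) v (lab x v)"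
    by (auto simp: V_def split: if_splits)
  moreover have "(\<Sum>(u, v)\<in>set \<sigma>. W u (lab x u) v (lab x v)) = (\<Sum>v<n. \<tau> v (lab x v))" (is "?w = ?t")
  proof -
    have "int p dvd coeff (Gtot x) (n * t) - int ?w"
      using H[of "n * t"] by (simp only: Htot_def coeff_diff coeff_cross[OF \<sigma> c])
    moreover have "int p dvd coeff (Gtot x) (n * t) - int ?t"
      using acc by (simp only: accepts_def sum_tauk)
    ultimately have "int p dvd (coeff (Gtot x) (n * t) - int ?w) - (coeff (Gtot x) (n * t) - int ?t)"
      by (rule dvd_diff)
    moreover have "(a - b) - (a - c) = c - b" for a b c :: int by simp
    ultimately have "int p dvd int ?t - int ?w" by (simp only:)
    then show ?thesis by (rule dvd_diff_imp_eq[OF sum_\<tau>_less sum_W_less[OF \<sigma>], symmetric])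
  qed
  ultimately show ?thesis by (simp add: certifies_def)
qed

text \<open>The message \<open>x\<close> is fixed independently of the random point. If the
  labelling is wrong, either no point is accepted, or \<open>Ftot\<close> or \<open>Htot\<close> is
  nonzero modulo \<open>p\<close> and every accepted point is one of its at most \<open>N\<close>
  roots.\<close>

lemma card_accepting_le:
  assumes \<sigma>: "valid_stream n \<sigma>"
    and x: "\<And>k c. k < t * t \<Longrightarrow> c < 4 * s \<Longrightarrow> x k c < p"
    and wrong: "\<not> certifies (lab x) \<sigma>" and B: "B \<le> p"
  shows "card {r. r < B \<and> accepts (int r) \<sigma> x} \<le> N"
proof -
  have bound: "card {r. r < B \<and> accepts (int r) \<sigma> x} \<le> N"
    if "\<And>r. accepts (int r) \<sigma> x \<Longrightarrow> int p dvd poly f (int r)" "\<not> int p dvd coeff f i" "degree f \<le> N" for f i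
  proof -
    have "card {r. r < B \<and> accepts (int r) \<sigma> x} \<le> card {r. r < p \<and> int p dvd poly f (int r)}"
      using that(1) B by (intro card_mono) auto
    also have "\<dots> \<le> degree f" using p that(2) by (rule card_roots_mod_prime_le)
    finally show ?thesis using that(3) by simp
  qed
  consider i where "\<not> int p dvd coeff (Ftot x) i" | i where "\<not> int p dvd coeff (Htot \<sigma> x) i"
    | "\<forall>i. int p dvd coeff (Ftot x) i" "\<forall>i. int p dvd coeff (Htot \<sigma> x) i" by blast
  then show ?thesis
  proof cases
    case 1
    show ?thesis by (rule bound[OF _ 1 degree_Ftot]) (simp add: accepts_def)
  next
    case 2
    show ?thesis by (rule bound[OF _ 2 degree_Htot[OF \<sigma>]]) (simp add: accepts_def)
  next
    case 3
    then have "\<not> accepts r \<sigma> x" for r using accepts_imp_certifies[OF \<sigma>, of x] x wrong by blast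
    then show ?thesis by simp
  qed
qed

text \<open>The product polynomial is written in terms of the labelling, not through
  \<open>Ztot\<close> of the message being defined, which would be circular. The zeros from
  \<open>4 * s\<close> on meet the padding of \<open>codec\<close>.\<close>

definition honest :: "(nat \<Rightarrow> nat) \<Rightarrow> (nat \<times> nat) list \<Rightarrow> nat \<Rightarrow> nat \<Rightarrow> nat" where
  "honest \<l> \<sigma> k c =
     (if 4 * s \<le> c then 0 else if c < s then \<l> (k div t * s + c) else if c < 2 * s then \<l> (k mod t * s + (c - s))
      else nat (coeff (\<Sum>j<s. Atot \<sigma> j * (\<Sum>i<t. \<Sum>u<n.
         monom (int (W u (\<l> u) (i * s + j) (\<l> (i * s + j)))) (n * t - (u * t + i))))
         (k * (2 * s) + (c - 2 * s)) mod int p))"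

lemma honest_less: "(\<And>v. v < n \<Longrightarrow> \<l> v < p) \<Longrightarrow> k < t * t \<Longrightarrow> honest \<l> \<sigma> k c < p"
proof -
  assume l: "\<And>v. v < n \<Longrightarrow> \<l> v < p" and k: "k < t * t"
  then have kt: "k div t < t" "k mod t < t" using t0 by (simp_all add: less_mult_imp_div_less)
  consider "c < s" "\<not> 4 * s \<le> c" | "\<not> c < s" "c < 2 * s" "\<not> 4 * s \<le> c" | "\<not> c < 2 * s" by linarith
  then show ?thesis
  proof cases
    case 1
    then show ?thesis using l[OF block_index[OF kt(1) 1(1)]] by (simp add: honest_def)
  next
    case 2
    then have "c - s < s" by linarith
    then show ?thesis using 2 l[OF block_index[OF kt(2)]] by (simp only: honest_def if_True if_False)
  next
    case 3
    then show ?thesis using prime_gt_0_nat[OF p] by (simp add: honest_def nat_less_iff)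
  qed
qed

lemma lab_honest: "lab (honest \<l> \<sigma>) v = \<l> v"
proof -
  have "\<not> 4 * s \<le> v mod s" "v mod s < s" using mod_less_divisor[OF s0, of v] by linarith+
  then have "honest \<l> \<sigma> (v div s * t) (v mod s) = \<l> (v div s * t div t * s + v mod s)"
    by (simp only: honest_def if_True if_False)
  then show ?thesis using t0 by (simp add: lab_def)
qed

lemma honest_consistent: "consistent (honest \<l> \<sigma>)"
  unfolding consistent_def using block_index by (auto simp: lab_honest honest_def)

lemma honest_accepts:
  assumes \<sigma>: "valid_stream n \<sigma>" and cert: "certifies \<l> \<sigma>"
  shows "accepts r \<sigma> (honest \<l> \<sigma>)"
proof -
  define x where "x = honest \<l> \<sigma>"
  have c: "consistent x" unfolding x_def by (rule honest_consistent)
  have lab: "lab x v = \<l> v" if "v < n" for v using that by (simp add: x_def lab_honest)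
  have "Ftot x = 0"
  proof (rule poly_eqI)
    fix e
    show "coeff (Ftot x) e = coeff 0 e"
    proof (cases "e < N")
      case True
      define k where "k = e div (2 * s)"
      define i where "i = k div t"
      define i' where "i' = k mod t"
      define d where "d = e mod (2 * s)"
      have k: "k < t * t" using True by (simp add: k_def N_def less_mult_imp_div_less)
      have i: "i < t" "i' < t" using k t0 by (simp_all add: i_def i'_def less_mult_imp_div_less)
      have ki: "k = i * t + i'" by (simp add: i_def i'_def)
      have d: "d < 2 * s" using s0 by (simp add: d_def)
      have "x k d = x (refk e) (refc e)"
      proof (cases "d < s")
        case True
        then show ?thesis using consistentD(1)[OF c i True] consistentD(1)[OF c i(1) t0 True]
          by (simp add: refk_def refc_def ki flip: k_def d_def) (simp add: i flip: ki i_def)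
      next
        case False
        then obtain j where j: "d = s + j" "j < s" using d by (metis add_less_cancel_left le_Suc_ex mult_2 not_less)
        then show ?thesis using consistentD(2)[OF c i j(2)] consistentD(1)[OF c i(2) t0 j(2)]
          by (simp add: refk_def refc_def ki flip: k_def d_def) (simp add: i flip: ki i'_def)
      qed
      then show ?thesis using True by (simp add: coeff_Ftot k_def d_def)
    next
      case False
      then show ?thesis by (simp add: Ftot_eq coeff_sum_monom_lessThan)
    qed
  qed
  moreover have "(\<Sum>k<t * t. viol k (x k)) = 0"
    using cert lab by (simp add: sum_viol[OF c] certifies_def)
  moreover have H: "int p dvd coeff (Htot \<sigma> x) e" for e
  proof -
    define Q where "Q = (\<Sum>j<s. Atot \<sigma> j * (\<Sum>i<t. \<Sum>u<n.
         monom (int (W u (\<l> u) (i * s + j) (\<l> (i * s + j)))) (n * t - (u * t + i))))"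
    have Q: "(\<Sum>j<s. Atot \<sigma> j * Ztot x j) = Q"
      unfolding Q_def by (intro sum.cong refl) (simp add: Ztot_eq[OF c] lab block_index)
    show ?thesis
    proof (cases "e < N")
      case True
      have "coeff (Gtot x) e = int (x (e div (2 * s)) (2 * s + e mod (2 * s)))"
        unfolding Gtot_eq coeff_sum_monom_lessThan using True by simp
      moreover have "\<not> 2 * s \<le> e mod (2 * s)" using s0 by (simp add: not_le)
      then have "int (x (e div (2 * s)) (2 * s + e mod (2 * s))) = int (nat (coeff Q e mod int p))"
        by (simp add: x_def honest_def Q_def div_mult_mod_eq)
      moreover have "int (nat (coeff Q e mod int p)) = coeff Q e mod int p"
        using prime_gt_0_nat[OF p] by simp
      ultimately have "coeff (Htot \<sigma> x) e = coeff Q e mod int p - coeff Q e"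
        by (simp add: Htot_def Q)
      also have "int p dvd \<dots>" by (rule mod_eq_dvd_iff[THEN iffD1]) simp
      finally show ?thesis .
    next
      case False
      then have "coeff Q e = 0"
        using degree_cross_less[OF \<sigma>, of x] by (intro coeff_eq_0) (simp add: Q)
      then show ?thesis using False by (simp add: Htot_def Q Gtot_eq coeff_sum_monom_lessThan)
    qed
  qed
  moreover have "int p dvd poly (Htot \<sigma> x) r"
    unfolding poly_altdef using H by (intro dvd_sum) auto
  moreover have "int p dvd coeff (Gtot x) (n * t) - int (\<Sum>k<t * t. tauk k (x k))"
  proof -
    have "(\<Sum>k<t * t. tauk k (x k)) = (\<Sum>v<n. \<tau> v (\<l> v))" by (simp add: sum_tauk lab)
    also have "\<dots> = (\<Sum>(u, v)\<in>set \<sigma>. W u (lab x u) v (lab x v))"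
    proof -
      have "(\<Sum>(u, v)\<in>set \<sigma>. W u (lab x u) v (lab x v)) = (\<Sum>(u, v)\<in>set \<sigma>. W u (\<l> u) v (\<l> v))"
        using \<sigma> by (intro sum.cong refl) (auto simp: lab valid_stream_def)
      then show ?thesis using cert by (simp add: certifies_def)
    qed
    finally show ?thesis using H[of "n * t"] by (simp only: Htot_def coeff_diff coeff_cross[OF \<sigma> c])
  qed
  ultimately show ?thesis unfolding x_def[symmetric] by (simp add: accepts_def)
qed

section \<open>The protocol as a sketch verifier\<close>

definition token_share :: "int \<Rightarrow> nat \<times> nat \<Rightarrow> nat \<Rightarrow> int" where
  "token_share r e c = (if c < s then poly (Apoly e c) r else 0)"

text \<open>All tested quantities are additive over tokens and help symbols except the products
  A_j(r) Z_j(r). The \<open>2 * s\<close> factors are therefore kept separately and multiplied in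
  \<open>verdict\<close>; the last of the five further counters carries the output.\<close>

definition help_share :: "int \<Rightarrow> nat \<Rightarrow> (nat \<Rightarrow> nat) \<Rightarrow> nat \<Rightarrow> int" where
  "help_share r k y c =
     (if c < s then 0
      else if c < 2 * s then poly (Zpoly k y (c - s)) r
      else if c = 2 * s then poly (Fpoly k y) r
      else if c = 2 * s + 1 then int (viol k y)
      else if c = 2 * s + 2 then poly (Gpoly k y) r
      else if c = 2 * s + 3 then coeff (Gpoly k y) (n * t) - int (tauk k y)
      else int (tauk k y))"

definition verdict :: "(nat \<Rightarrow> int) \<Rightarrow> nat option" where
  "verdict V =
     (if V (2 * s) = 0 \<and> V (2 * s + 1) = 0 \<and>
         (V (2 * s + 2) - (\<Sum>j<s. V j * V (s + j))) mod int p = 0 \<and> V (2 * s + 3) = 0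
      then Some (nat (V (2 * s + 4))) else None)"

lemma verdict_eq:
  assumes "distinct \<sigma>"
  shows "verdict (\<lambda>c\<in>{..<2 * s + 5}.
      ((\<Sum>e\<leftarrow>\<sigma>. token_share r e c) + (\<Sum>k<t * t. help_share r k (x k) c)) mod int p) =
    (if accepts r \<sigma> x then Some ((\<Sum>v<n. \<tau> v (lab x v))) else None)" (is "verdict ?V = _")
proof -
  define V where "V = ?V"
  have list: "(\<Sum>e\<leftarrow>\<sigma>. g e) = (\<Sum>e\<in>set \<sigma>. g e)" for g :: "nat \<times> nat \<Rightarrow> int"
    using assms by (rule sum_list_distinct_conv_sum_set)
  have VA: "V j = poly (Atot \<sigma> j) r mod int p" if "j < s" for j
    using that by (simp add: V_def list token_share_def help_share_def Atot_def poly_sum)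
  have VZ: "V (s + j) = poly (Ztot x j) r mod int p" if "j < s" for j
    using that by (simp add: V_def list token_share_def help_share_def Ztot_def poly_sum)
  have VF: "V (2 * s) = poly (Ftot x) r mod int p"
    by (simp add: V_def list token_share_def help_share_def Ftot_def poly_sum)
  have VV: "V (2 * s + 1) = int (\<Sum>k<t * t. viol k (x k)) mod int p"
    by (simp add: V_def list token_share_def help_share_def)
  have VG: "V (2 * s + 2) = poly (Gtot x) r mod int p"
    by (simp add: V_def list token_share_def help_share_def Gtot_def poly_sum)
  have VD: "V (2 * s + 3) = (coeff (Gtot x) (n * t) - int (\<Sum>k<t * t. tauk k (x k))) mod int p"
    by (simp add: V_def list token_share_def help_share_def Gtot_def coeff_sum sum_subtractf)
  have "V (2 * s + 4) = int (\<Sum>k<t * t. tauk k (x k)) mod int p"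
    by (simp add: V_def list token_share_def help_share_def)
  \<comment> \<open>The count is at most n < p, so its residue is the count itself.\<close>
  then have VT: "V (2 * s + 4) = int (\<Sum>v<n. \<tau> v (lab x v))"
    using sum_\<tau>_less[of "lab x"] by (simp only: sum_tauk zmod_int[symmetric] mod_less)
  have "int p dvd V j * V (s + j) - poly (Atot \<sigma> j) r * poly (Ztot x j) r" if "j < s" for j
    using that by (intro mod_eq_dvd_iff[THEN iffD1]) (simp add: VA VZ mod_mult_eq)
  then have "int p dvd (\<Sum>j<s. V j * V (s + j) - poly (Atot \<sigma> j) r * poly (Ztot x j) r)"
    by (intro dvd_sum) auto
  moreover have "int p dvd V (2 * s + 2) - poly (Gtot x) r"
    by (rule mod_eq_dvd_iff[THEN iffD1]) (simp only: VG mod_mod_trivial)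
  ultimately have "int p dvd (V (2 * s + 2) - poly (Gtot x) r) -
      (\<Sum>j<s. V j * V (s + j) - poly (Atot \<sigma> j) r * poly (Ztot x j) r)" by (rule dvd_diff[rotated])
  also have "\<dots> = (V (2 * s + 2) - (\<Sum>j<s. V j * V (s + j))) - poly (Htot \<sigma> x) r"
    by (simp add: Htot_def poly_sum sum_subtractf)
  finally have "(V (2 * s + 2) - (\<Sum>j<s. V j * V (s + j))) mod int p = poly (Htot \<sigma> x) r mod int p"
    by (rule mod_eq_dvd_iff[THEN iffD2])
  then have "verdict V = (if accepts r \<sigma> x then Some ((\<Sum>v<n. \<tau> v (lab x v))) else None)"
    unfolding verdict_def VF VV VD VT accepts_def dvd_eq_mod_eq_0 by (simp only: nat_int)
  then show ?thesis by (simp only: V_def)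
qed

text \<open>The \<open>b\<close> random bits select a point below 2^b <= p. At most \<open>N\<close>
  points accept a wrong labelling, and \<open>3 * N \<le> 2 ^ b\<close> turns this into error 1/3; a
  certifying labelling yields the right output whatever else was sent.\<close>

lemma protocol_scheme:
  assumes complete: "\<And>\<sigma>. valid_stream n \<sigma> \<Longrightarrow> \<exists>\<l>. (\<forall>v<n. \<l> v < p) \<and> certifies \<l> \<sigma>"
    and sound: "\<And>\<sigma> \<l>. valid_stream n \<sigma> \<Longrightarrow> certifies \<l> \<sigma> \<Longrightarrow> (\<Sum>v<n. \<tau> v (\<l> v)) = f \<sigma>"
    and pq: "p \<le> 2 ^ q" and bp: "2 ^ b \<le> p" and Nb: "3 * N \<le> 2 ^ b" and ta: "t * t + 2 \<le> 2 ^ a"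
  shows "\<exists>P. is_scheme_for f n P \<and> help_bounded P n (t * t * (q * (4 * s))) \<and>
    space_bounded P (a + q * (4 * s) + q * (2 * s + 5))"
proof -
  define L where "L = q * (4 * s)"
  have p0: "p > 0" using p by (rule prime_gt_0_nat)
  have "q \<noteq> 0" using pq prime_gt_1_nat[OF p] by (intro notI) simp
  then have L0: "L > 0" using s0 by (simp add: L_def)
  obtain enc dec where codec: "codec p (4 * s) L enc dec"
    unfolding L_def using codec_exists[OF p0 pq] by blast
  have dec_less: "dec bl c < p" if "c < 4 * s" for bl c
    using codec that by (simp add: codec_def)
  have length_enc: "length (enc y) = L" for y
    using codec by (simp add: codec_def)
  have dec_enc: "dec (enc y) = y" if "\<And>c. c < 4 * s \<Longrightarrow> y c < p" "\<And>c. 4 * s \<le> c \<Longrightarrow> y c = 0" for y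
    using codec that by (simp add: codec_def)
  define R where "R = {\<rho> :: bool list. length \<rho> = b}"
  have finR: "finite R" and cR: "card R = 2 ^ b"
    using finite_lists_length_eq[of "UNIV :: bool set" b] card_lists_length_eq[of "UNIV :: bool set" b]
    by (simp_all add: R_def)
  obtain num where num: "bij_betw num R {..<(2::nat) ^ b}"
    using finite_same_card_bij[OF finR finite_lessThan] cR by auto
  define cert where "cert \<sigma> = (SOME \<l>. (\<forall>v<n. \<l> v < p) \<and> certifies \<l> \<sigma>)" for \<sigma>
  have cert: "(\<forall>v<n. cert \<sigma> v < p) \<and> certifies (cert \<sigma>) \<sigma>" if "valid_stream n \<sigma>" for \<sigma>
    unfolding cert_def by (rule someI_ex[OF complete[OF that]])
  define pv where "pv \<sigma> = concat (map (\<lambda>k. enc (honest (cert \<sigma>) \<sigma> k)) [0..<t * t])" for \<sigma>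
  have pv_length: "length (pv \<sigma>) = t * t * L" for \<sigma>
    by (simp add: pv_def length_concat comp_def length_enc sum_list_triv)
  interpret V: sketch_verifier L "t * t" "2 * s + 5" p "\<lambda>\<rho>. token_share (int (num \<rho>))"
      "\<lambda>\<rho> k bl. help_share (int (num \<rho>)) k (dec bl)" "\<lambda>_. verdict"
    by unfold_locales (use L0 p0 in auto)
  obtain P where P: "rbits P = b" "prover P = pv" "space_bounded P (a + L + q * (2 * s + 5))"
    and run: "\<forall>\<rho> \<sigma> w. run_scheme P \<rho> \<sigma> w =
      (if length w = t * t * L
       then verdict (\<lambda>c\<in>{..<2 * s + 5}. ((\<Sum>e\<leftarrow>\<sigma>. token_share (int (num \<rho>)) e c) +
         (\<Sum>k<t * t. help_share (int (num \<rho>)) k (dec (block L w k)) c)) mod int p) else None)"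
    using V.scheme_exists[OF ta pq, of b pv] by (elim exE conjE) (rule that)
  have run': "run_scheme P \<rho> \<sigma> w =
      (if length w = t * t * L \<and> accepts (int (num \<rho>)) \<sigma> (\<lambda>k. dec (block L w k))
       then Some (\<Sum>v<n. \<tau> v (lab (\<lambda>k. dec (block L w k)) v)) else None)"
    if "valid_stream n \<sigma>" for \<rho> \<sigma> w
  proof -
    have "distinct \<sigma>" using that by (simp add: valid_stream_def)
    then show ?thesis unfolding run[rule_format] using verdict_eq[of \<sigma> "int (num \<rho>)" "\<lambda>k. dec (block L w k)"] by simp
  qed
  have "run_scheme P \<rho> \<sigma> (pv \<sigma>) = Some (f \<sigma>)" if \<sigma>: "valid_stream n \<sigma>" for \<rho> \<sigma>
  proof -
    define h where "h = honest (cert \<sigma>) \<sigma>"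
    define x where "x = (\<lambda>k. dec (block L (pv \<sigma>) k))"
    have x: "x k = h k" if "k < t * t" for k
    proof -
      have "block L (pv \<sigma>) k = enc (h k)"
        unfolding pv_def using that by (subst block_concat) (auto simp: length_enc h_def)
      moreover have "h k c < p" for c
        unfolding h_def using cert[OF \<sigma>] that by (intro honest_less) auto
      moreover have "h k c = 0" if "4 * s \<le> c" for c using that by (simp add: h_def honest_def)
      ultimately show ?thesis unfolding x_def by (metis dec_enc)
    qed
    have "accepts r \<sigma> x \<longleftrightarrow> accepts r \<sigma> h" for r
      by (simp add: accepts_def Ftot_def Gtot_def Htot_def Ztot_def x)
    then have "accepts r \<sigma> x" for r
      unfolding h_def using honest_accepts[OF \<sigma>] cert[OF \<sigma>] by blast
    moreover have "(\<Sum>v<n. \<tau> v (lab x v)) = (\<Sum>v<n. \<tau> v (cert \<sigma> v))"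
    proof (intro sum.cong refl)
      fix v assume "v \<in> {..<n}"
      then have v: "v < n" by simp
      then have "v div s < t" unfolding ts[symmetric] by (rule less_mult_imp_div_less)
      then have "v div s * t < t * t" using t0 by simp
      then have "lab x v = lab h v" by (simp add: lab_def x)
      then show "\<tau> v (lab x v) = \<tau> v (cert \<sigma> v)" using v by (simp add: h_def lab_honest)
    qed
    ultimately show ?thesis using sound[OF \<sigma>] cert[OF \<sigma>] pv_length
      by (simp add: run'[OF \<sigma>] flip: x_def)
  qed
  moreover have "3 * card {\<rho>. length \<rho> = b \<and> run_scheme P \<rho> \<sigma> w \<notin> {Some (f \<sigma>), None}} \<le> 2 ^ b"
    if \<sigma>: "valid_stream n \<sigma>" for \<sigma> w
  proof -
    define x where "x = (\<lambda>k. dec (block L w k))"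
    have xp: "x k c < p" if "c < 4 * s" for k c using that by (simp add: x_def dec_less)
    show ?thesis
    proof (cases "certifies (lab x) \<sigma>")
      case True
      then have "run_scheme P \<rho> \<sigma> w \<in> {Some (f \<sigma>), None}" for \<rho>
        using sound[OF \<sigma> True] by (simp add: run'[OF \<sigma>] flip: x_def)
      then show ?thesis by simp
    next
      case False
      have "{\<rho>. length \<rho> = b \<and> run_scheme P \<rho> \<sigma> w \<notin> {Some (f \<sigma>), None}} \<subseteq>
          {\<rho> \<in> R. accepts (int (num \<rho>)) \<sigma> x}"
        by (auto simp: R_def run'[OF \<sigma>] x_def split: if_splits)
      then have "card {\<rho>. length \<rho> = b \<and> run_scheme P \<rho> \<sigma> w \<notin> {Some (f \<sigma>), None}} \<le>
          card {\<rho> \<in> R. accepts (int (num \<rho>)) \<sigma> x}" using finR by (intro card_mono) auto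
      also have "\<dots> \<le> card {r. r < 2 ^ b \<and> accepts (int r) \<sigma> x}"
      proof (rule card_inj_on_le)
        show "inj_on num {\<rho> \<in> R. accepts (int (num \<rho>)) \<sigma> x}"
          using num by (auto simp: bij_betw_def intro: inj_on_subset)
        show "num ` {\<rho> \<in> R. accepts (int (num \<rho>)) \<sigma> x} \<subseteq> {r. r < 2 ^ b \<and> accepts (int r) \<sigma> x}"
          using num by (auto simp: bij_betw_def)
      qed simp
      also have "\<dots> \<le> N" using \<sigma> xp False bp by (intro card_accepting_le) auto
      finally show ?thesis using Nb by linarith
    qed
  qed
  ultimately have "is_scheme_for f n P" by (simp add: is_scheme_for_def P)
  moreover have "help_bounded P n (t * t * L)" by (simp add: help_bounded_def P pv_length)
  ultimately show ?thesis using P(3) unfolding L_def by blast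
qed

end

section \<open>The scheme for maximum matching\<close>

text \<open>The default \<open>d\<close> stands for an uncovered vertex: it will be
  \<open>n\<close>, no vertex at all, for mates, and the vertex itself for buddies, which makes the
  latter an involution.\<close>

definition partner :: "(nat \<times> nat) set \<Rightarrow> nat \<Rightarrow> nat \<Rightarrow> nat" where
  "partner M d v = (if v \<in> covered M then (THE w. (v, w) \<in> M \<or> (w, v) \<in> M) else d)"

lemma partner_edge:
  assumes E: "simple_on n E" and M: "is_matching E M" and e: "(u, v) \<in> M"
  shows "partner M d u = v" "partner M d v = u"
proof -
  have cov: "u \<in> covered M" "v \<in> covered M" using e by (force simp: covered_def)+
  have less: "a < b" if "(a, b) \<in> M" for a b
    using that E M by (auto simp: simple_on_def is_matching_def)
  have uniq: "e' = (u, v)" if "e' \<in> M" "x \<in> ends e'" "x = u \<or> x = v" for e' x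
    using matching_unique[OF M that(1) e that(2)] that(3) by auto
  have "w = v" if "(u, w) \<in> M \<or> (w, u) \<in> M" for w
    using that uniq[of "(u, w)" u] uniq[of "(w, u)" u] less[OF e] by auto
  then have "(THE w. (u, w) \<in> M \<or> (w, u) \<in> M) = v" using e by (intro the_equality) auto
  then show "partner M d u = v" using cov by (simp add: partner_def)
  have "w = u" if "(v, w) \<in> M \<or> (w, v) \<in> M" for w
    using that uniq[of "(v, w)" v] uniq[of "(w, v)" v] less[OF e] by auto
  then have "(THE w. (v, w) \<in> M \<or> (w, v) \<in> M) = u" using e by (intro the_equality) auto
  then show "partner M d v = u" using cov by (simp add: partner_def)
qed

lemma partner_cases:
  assumes E: "simple_on n E" and M: "is_matching E M"
  obtains "v \<notin> covered M" "partner M d v = d"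
  | w where "(v, w) \<in> M" "partner M d v = w" "partner M d w = v"
  | w where "(w, v) \<in> M" "partner M d v = w" "partner M d w = v"
proof (cases "v \<in> covered M")
  case True
  then obtain e where "e \<in> M" "v \<in> ends e" by (auto simp: covered_def)
  then obtain w where "(v, w) \<in> M \<or> (w, v) \<in> M" by (cases e) auto
  then show ?thesis using that partner_edge[OF E M] by blast
qed (use that in \<open>auto simp: partner_def\<close>)

text \<open>Base n + 1, since a mate may be \<open>n\<close> (unmatched) and classes run from 0 (the
  barrier) to \<open>n\<close>.\<close>

definition enc_label :: "nat \<Rightarrow> nat \<Rightarrow> nat \<Rightarrow> nat \<Rightarrow> nat" where
  "enc_label n c m b = (c * (n + 1) + m) * (n + 1) + b"

definition label_class :: "nat \<Rightarrow> nat \<Rightarrow> nat" where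
  "label_class n x = x div (n + 1) div (n + 1)"

definition label_mate :: "nat \<Rightarrow> nat \<Rightarrow> nat" where
  "label_mate n x = x div (n + 1) mod (n + 1)"

definition label_buddy :: "nat \<Rightarrow> nat \<Rightarrow> nat" where
  "label_buddy n x = x mod (n + 1)"

lemma label_simps:
  assumes "m \<le> n" "b \<le> n"
  shows "label_class n (enc_label n c m b) = c" "label_mate n (enc_label n c m b) = m"
    "label_buddy n (enc_label n c m b) = b"
proof -
  have "enc_label n c m b div (n + 1) = c * (n + 1) + m"
    using assms unfolding enc_label_def by (subst div_mult_self3) auto
  moreover have "(c * (n + 1) + m) div (n + 1) = c" using assms by (subst div_mult_self3) auto
  moreover have "(c * (n + 1) + m) mod (n + 1) = m" using assms by (subst mod_mult_self3) auto
  ultimately show "label_class n (enc_label n c m b) = c" "label_mate n (enc_label n c m b) = m"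
    by (simp_all only: label_class_def label_mate_def)
  show "label_buddy n (enc_label n c m b) = b"
    using assms unfolding enc_label_def label_buddy_def by (subst mod_mult_self3) auto
qed

lemma enc_label_less:
  assumes "c \<le> n" "m \<le> n" "b \<le> n"
  shows "enc_label n c m b < (n + 1) ^ 3"
proof -
  have "c * (n + 1) + m < Suc c * (n + 1)" using assms by simp
  also have "\<dots> \<le> (n + 1) * (n + 1)" using assms by (intro mult_le_mono1) simp
  finally have 1: "Suc (c * (n + 1) + m) \<le> (n + 1) * (n + 1)" by simp
  have "enc_label n c m b < Suc (c * (n + 1) + m) * (n + 1)" using assms by (simp add: enc_label_def)
  also have "\<dots> \<le> (n + 1) * (n + 1) * (n + 1)" using 1 by (rule mult_le_mono1)
  finally show ?thesis by (simp add: power3_eq_cube)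
qed

text \<open>A label consists of a class (0 for the barrier set \<open>U\<close>), the partner in a matching, and a
  buddy in the same class. If the buddies form an involution with at most one fixed point per
  class, then \<open>\<Sum>v. label_count\<close> is \<open>|U|\<close> plus the sum over the classes \<open>C\<close> of
  \<open>\<lfloor>|C| / 2\<rfloor>\<close>. An edge between different classes has weight above \<open>n\<close>.\<close>

definition label_ok :: "nat \<Rightarrow> nat \<Rightarrow> nat \<Rightarrow> nat \<Rightarrow> nat \<Rightarrow> bool" where
  "label_ok n u x v y \<longleftrightarrow> label_class n x \<noteq> 0 \<longrightarrow>
     label_buddy n x < n \<and>
     (label_buddy n x = v \<longrightarrow> label_buddy n y = u \<and> label_class n y = label_class n x) \<and>
     (u \<noteq> v \<and> label_class n x = label_class n y \<longrightarrow> \<not> (label_buddy n x = u \<and> label_buddy n y = v))"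

definition label_weight :: "nat \<Rightarrow> nat \<Rightarrow> nat \<Rightarrow> nat \<Rightarrow> nat \<Rightarrow> nat" where
  "label_weight n u x v y = (if label_mate n x = v \<and> label_mate n y = u then 1 else 0) +
     (if label_class n x \<noteq> 0 \<and> label_class n y \<noteq> 0 \<and> label_class n x \<noteq> label_class n y then n + 1 else 0)"

definition label_count :: "nat \<Rightarrow> nat \<Rightarrow> nat \<Rightarrow> nat" where
  "label_count n v x = (if label_class n x = 0 \<or> label_buddy n x < v then 1 else 0)"

lemma sum_indicator_card: "finite A \<Longrightarrow> (\<Sum>x\<in>A. if P x then 1 else 0) = card {x \<in> A. P x}"
  by (simp add: sum.If_cases Int_def)

lemma sum_label_count:
  "(\<Sum>v<n. label_count n v (\<l> v)) = card {v. v < n \<and> (label_class n (\<l> v) = 0 \<or> label_buddy n (\<l> v) < v)}"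
  by (simp add: label_count_def sum_indicator_card)

text \<open>Edges whose ends name each other as mates form a matching of size equal to the weight
  sum, so the count is at most the matching number. Conversely, the buddies meet the conditions of
  \<open>card_matching_le_cover\<close>, so the count bounds every matching.\<close>

lemma label_sound:
  assumes E: "simple_on n E"
    and ok: "\<forall>u<n. \<forall>v<n. label_ok n u (\<l> u) v (\<l> v)"
    and eq: "(\<Sum>(u, v)\<in>E. label_weight n u (\<l> u) v (\<l> v)) = (\<Sum>v<n. label_count n v (\<l> v))"
  shows "(\<Sum>v<n. label_count n v (\<l> v)) = matching_number E"
proof (rule antisym)
  have finE: "finite E" using E by (rule simple_on_finite)
  define T where "T = (\<Sum>v<n. label_count n v (\<l> v))"
  have "T \<le> (\<Sum>v<n. 1)" unfolding T_def by (intro sum_mono) (simp add: label_count_def)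
  then have Tn: "T \<le> n" by simp
  \<comment> \<open>The total weight equals a count of at most \<open>n\<close>, so no edge can
    carry the penalty n + 1; edges outside the barrier stay within a class.\<close>
  have w_le: "label_weight n u (\<l> u) v (\<l> v) \<le> n" if "(u, v) \<in> E" for u v
  proof -
    have "(case (u, v) of (u, v) \<Rightarrow> label_weight n u (\<l> u) v (\<l> v)) \<le>
        (\<Sum>(u, v)\<in>E. label_weight n u (\<l> u) v (\<l> v))"
      using that finE by (intro member_le_sum) auto
    then show ?thesis using eq Tn by (simp add: T_def)
  qed
  have same: "label_class n (\<l> u) = label_class n (\<l> v)"
    if "(u, v) \<in> E" "label_class n (\<l> u) \<noteq> 0" "label_class n (\<l> v) \<noteq> 0" for u v
    using w_le[OF that(1)] that(2,3) by (auto simp: label_weight_def split: if_splits)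
  define M where "M = {(u, v) \<in> E. label_mate n (\<l> u) = v \<and> label_mate n (\<l> v) = u}"
  have "is_matching E M" unfolding is_matching_def
  proof (intro conjI ballI impI)
    show "M \<subseteq> E" by (auto simp: M_def)
    fix e e' assume ee: "e \<in> M" "e' \<in> M" "e \<noteq> e'"
    obtain u v u' v' where uv: "e = (u, v)" "e' = (u', v')" by (cases e; cases e') auto
    have "u < v" "u' < v'" using ee uv simple_onD[OF E, of e] simple_onD[OF E, of e'] by (auto simp: M_def)
    then show "ends e \<inter> ends e' = {}" using ee uv by (auto simp: M_def)
  qed
  then have "card M \<le> matching_number E" by (rule card_matching_le[OF finE])
  moreover have "(\<Sum>(u, v)\<in>E. label_weight n u (\<l> u) v (\<l> v)) = card M"
  proof -
    have "(\<Sum>(u, v)\<in>E. label_weight n u (\<l> u) v (\<l> v)) = (\<Sum>e\<in>E. if e \<in> M then 1 else 0)"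
    proof (rule sum.cong[OF refl], clarify)
      fix u v assume uv: "(u, v) \<in> E"
      then have "\<not> (label_class n (\<l> u) \<noteq> 0 \<and> label_class n (\<l> v) \<noteq> 0 \<and>
          label_class n (\<l> u) \<noteq> label_class n (\<l> v))" using same[OF uv] by blast
      then show "label_weight n u (\<l> u) v (\<l> v) = (if (u, v) \<in> M then 1 else 0)"
        using uv by (simp only: label_weight_def M_def) simp
    qed
    moreover have "(\<Sum>e\<in>E. if e \<in> M then 1 else 0) = card {e \<in> E. e \<in> M}"
      using finE by (rule sum_indicator_card)
    moreover have "{e \<in> E. e \<in> M} = M" by (auto simp: M_def)
    ultimately show ?thesis by (simp only:)
  qed
  ultimately show "(\<Sum>v<n. label_count n v (\<l> v)) \<le> matching_number E" using eq by simp
  define U where "U = {v. v < n \<and> label_class n (\<l> v) = 0}"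
  obtain M' where M': "is_max_matching E M'" using finE by (rule max_matching_exists)
  have "card M' \<le> card {v. v < n \<and> (v \<in> U \<or> label_buddy n (\<l> v) < v)}"
  proof (rule card_matching_le_cover[OF E, where cls = "\<lambda>v. label_class n (\<l> v)"])
    show "is_matching E M'" using M' by (simp add: is_max_matching_def)
    show "U \<subseteq> {..<n}" by (auto simp: U_def)
    show "label_class n (\<l> u) = label_class n (\<l> v)" if "(u, v) \<in> avoiding U E" for u v
    proof (rule same)
      show "(u, v) \<in> E" using that by (simp add: avoiding_def)
      then have "u < n" "v < n" using simple_onD[OF E] by fastforce+
      then show "label_class n (\<l> u) \<noteq> 0" "label_class n (\<l> v) \<noteq> 0"
        using that by (auto simp: avoiding_def U_def)
    qed
    show "label_buddy n (\<l> v) \<in> {..<n} - U \<and> label_buddy n (\<l> (label_buddy n (\<l> v))) = v \<and>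
        label_class n (\<l> (label_buddy n (\<l> v))) = label_class n (\<l> v)" if "v \<in> {..<n} - U" for v
    proof -
      have v: "v < n" "label_class n (\<l> v) \<noteq> 0" using that by (auto simp: U_def)
      then have b: "label_buddy n (\<l> v) < n" using ok unfolding label_ok_def by blast
      then have "label_ok n v (\<l> v) (label_buddy n (\<l> v)) (\<l> (label_buddy n (\<l> v)))"
        using ok v(1) by blast
      then show ?thesis using v b by (simp add: label_ok_def U_def)
    qed
    show "u = v" if "u \<in> {..<n} - U" "v \<in> {..<n} - U" "label_class n (\<l> u) = label_class n (\<l> v)"
      "label_buddy n (\<l> u) = u" "label_buddy n (\<l> v) = v" for u v
    proof -
      have uv: "u < n" "v < n" "label_class n (\<l> u) \<noteq> 0" using that by (auto simp: U_def)
      then have "label_ok n u (\<l> u) v (\<l> v)" using ok by blast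
      then show ?thesis using uv that(3-5) by (auto simp: label_ok_def)
    qed
  qed
  also have "{v. v < n \<and> (v \<in> U \<or> label_buddy n (\<l> v) < v)} =
      {v. v < n \<and> (label_class n (\<l> v) = 0 \<or> label_buddy n (\<l> v) < v)}" by (auto simp: U_def)
  finally show "matching_number E \<le> (\<Sum>v<n. label_count n v (\<l> v))"
    using M' by (simp add: sum_label_count is_max_matching_def)
qed

text \<open>Two matchings enter: mates come from a maximum matching of the whole graph, buddies from
  the matching \<open>M0\<close> of the certificate, which avoids the barrier. Classes are shifted
  by one to free 0 for the barrier.\<close>

lemma label_complete:
  assumes E: "simple_on n E"
  shows "\<exists>\<l>. (\<forall>v<n. \<l> v < (n + 1) ^ 3) \<and>
    (\<forall>u<n. \<forall>v<n. label_ok n u (\<l> u) v (\<l> v)) \<and>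
    (\<Sum>(u, v)\<in>E. label_weight n u (\<l> u) v (\<l> v)) = (\<Sum>v<n. label_count n v (\<l> v))"
proof -
  have finE: "finite E" using E by (rule simple_on_finite)
  obtain U M0 cls where "tutte_berge_certificate n E U M0 cls" using tutte_berge[OF E] by blast
  then have U: "U \<subseteq> {..<n}" and M0: "is_matching (avoiding U E) M0"
    and num: "matching_number E = card U + card M0"
    and cls: "\<And>u v. (u, v) \<in> avoiding U E \<Longrightarrow> cls u = cls v"
    and sep: "\<And>u v. u \<noteq> v \<Longrightarrow> cls u = cls v \<Longrightarrow> u \<in> covered M0 \<or> v \<in> covered M0"
    and cls_le: "\<And>v. cls v \<le> v"
    unfolding tutte_berge_certificate_def by auto
  obtain M where "is_max_matching E M" using finE by (rule max_matching_exists)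
  then have M: "is_matching E M" and cM: "card M = matching_number E" by (auto simp: is_max_matching_def)
  define A where "A = avoiding U E"
  have A: "simple_on n A" using E avoiding_subset unfolding A_def by (rule simple_on_mono)
  have M0A: "is_matching A M0" using M0 by (simp add: A_def)
  have M0_props: "u < v \<and> v < n \<and> u \<notin> U \<and> v \<notin> U \<and> cls u = cls v" if "(u, v) \<in> M0" for u v
  proof -
    have "(u, v) \<in> avoiding U E" using that M0 by (auto simp: is_matching_def)
    then show ?thesis using simple_onD[OF E, of "(u, v)"] cls by (auto simp: avoiding_def)
  qed
  define mate where "mate = partner M n"
  define bud where "bud v = partner M0 v v" for v
  have bud_edge: "bud u = v \<and> bud v = u" if "(u, v) \<in> M0" for u v
    using partner_edge[OF A M0A that] by (simp add: bud_def)
  have bud: "v \<notin> covered M0 \<and> bud v = v \<or> (v, bud v) \<in> M0 \<or> (bud v, v) \<in> M0" for v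
    using partner_cases[OF A M0A, of v v] unfolding bud_def by metis
  have mate_edge: "mate u = v \<and> mate v = u" if "(u, v) \<in> M" for u v
    using partner_edge[OF E M that] by (simp add: mate_def)
  have mate: "mate v = n \<or> (v, mate v) \<in> M \<or> (mate v, v) \<in> M" for v
    using partner_cases[OF E M, of v n] unfolding mate_def by metis
  have less: "u < v \<and> v < n" if "(u, v) \<in> E" for u v using simple_onD[OF E that] by simp
  have ME: "M \<subseteq> E" using M by (simp add: is_matching_def)
  define c where "c v = (if v \<in> U then 0 else cls v + 1)" for v
  define \<l> where "\<l> v = enc_label n (c v) (mate v) (bud v)" for v
  have mate_le: "mate v \<le> n" for v using mate[of v] ME less by force
  have bud_less: "bud v < n" if "v < n" for v using bud[of v] that M0_props by force
  have bud_bud: "bud (bud v) = v" for v using bud[of v] bud_edge by metis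
  have c_bud: "c (bud v) = c v" for v using bud[of v] M0_props by (auto simp: c_def)
  have c_le: "c v \<le> n" if "v < n" for v using that cls_le[of v] by (auto simp: c_def)
  have l_simps: "label_class n (\<l> v) = c v" "label_mate n (\<l> v) = mate v" "label_buddy n (\<l> v) = bud v"
    if "v < n" for v
    using label_simps[of "mate v" n "bud v" "c v"] mate_le[of v] bud_less[OF that] by (simp_all add: \<l>_def)
  have "\<l> v < (n + 1) ^ 3" if "v < n" for v
    unfolding \<l>_def using that by (intro enc_label_less c_le mate_le less_imp_le[OF bud_less])
  moreover have "label_ok n u (\<l> u) v (\<l> v)" if "u < n" "v < n" for u v
  proof -
    have "\<not> (u \<noteq> v \<and> c u = c v \<and> c u \<noteq> 0 \<and> bud u = u \<and> bud v = v)"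
    proof
      assume h: "u \<noteq> v \<and> c u = c v \<and> c u \<noteq> 0 \<and> bud u = u \<and> bud v = v"
      then have "cls u = cls v" by (auto simp: c_def split: if_splits)
      then have "u \<in> covered M0 \<or> v \<in> covered M0" using sep h by blast
      then show False using bud[of u] bud[of v] h M0_props by fastforce
    qed
    then show ?thesis using that bud_less bud_bud c_bud by (auto simp: label_ok_def l_simps)
  qed
  moreover have "(\<Sum>(u, v)\<in>E. label_weight n u (\<l> u) v (\<l> v)) = card M"
  proof -
    have "(\<Sum>(u, v)\<in>E. label_weight n u (\<l> u) v (\<l> v)) = (\<Sum>e\<in>E. if e \<in> M then 1 else 0)"
    proof (rule sum.cong[OF refl], clarify)
      fix u v assume uv: "(u, v) \<in> E"
      have "(mate u = v \<and> mate v = u) = ((u, v) \<in> M)"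
        using mate[of u] mate_edge[of u v] less[OF uv] ME less by force
      moreover have "\<not> (c u \<noteq> 0 \<and> c v \<noteq> 0 \<and> c u \<noteq> c v)"
        using cls[of u v] uv by (auto simp: c_def avoiding_def split: if_splits)
      ultimately show "label_weight n u (\<l> u) v (\<l> v) = (if (u, v) \<in> M then 1 else 0)"
        using less[OF uv] by (simp add: label_weight_def l_simps)
    qed
    also have "\<dots> = card {e \<in> E. e \<in> M}" using finE by (rule sum_indicator_card)
    also have "{e \<in> E. e \<in> M} = M" using ME by auto
    finally show ?thesis .
  qed
  moreover have "(\<Sum>v<n. label_count n v (\<l> v)) = card U + card M0"
  proof -
    \<comment> \<open>Outside the barrier, \<open>bud v < v\<close> singles out the larger end of
      each edge of \<open>M0\<close>.\<close>
    have "{v. v < n \<and> (label_class n (\<l> v) = 0 \<or> label_buddy n (\<l> v) < v)} = U \<union> snd ` M0"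
    proof (intro equalityI subsetI)
      fix v assume v: "v \<in> {v. v < n \<and> (label_class n (\<l> v) = 0 \<or> label_buddy n (\<l> v) < v)}"
      show "v \<in> U \<union> snd ` M0"
      proof (cases "v \<in> U")
        case False
        then have "bud v < v" using v by (auto simp: l_simps c_def)
        then have "(bud v, v) \<in> M0" using bud[of v] M0_props[of v "bud v"] by auto
        then show ?thesis by force
      qed simp
    next
      fix v assume "v \<in> U \<union> snd ` M0"
      then consider "v \<in> U" | u where "(u, v) \<in> M0" by force
      then show "v \<in> {v. v < n \<and> (label_class n (\<l> v) = 0 \<or> label_buddy n (\<l> v) < v)}"
      proof cases
        case 1
        then have "v < n" using U by auto
        then show ?thesis using 1 by (simp add: l_simps c_def)
      next
        case 2
        then show ?thesis using M0_props[OF 2] bud_edge[OF 2] by (simp add: l_simps)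
      qed
    qed
    moreover have "U \<inter> snd ` M0 = {}" using M0_props by force
    moreover have "inj_on snd M0"
      using M0A by (auto simp: inj_on_def is_matching_def)
    moreover have "finite M0" using matching_finite[OF simple_on_finite[OF A] M0A] .
    moreover have "finite U" using U finite_subset by blast
    ultimately show ?thesis by (simp add: sum_label_count card_Un_disjoint card_image)
  qed
  ultimately show ?thesis using num cM by (intro exI[of _ \<l>]) simp
qed

lemma matching_scheme_exists:
  assumes ts: "t * s = n" "t > 0" "s > 0" and e: "n + 2 \<le> 2 ^ e"
  shows "\<exists>P. is_scheme_for max_matching_size n P \<and>
    help_bounded P n (t * t * ((6 * e + 10) * (4 * s))) \<and>
    space_bounded P (2 * e + (6 * e + 10) * (4 * s) + (6 * e + 10) * (2 * s + 5))"
proof -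
  \<comment> \<open>Chosen so that 8 (n+2)^3 <= 2^b < p. This one inequality covers the range of the
    labels, the total weight n^2 (n+2), and 3N = 6nt; the prime then fits in 2b + 4 = 6e + 10
    bits.\<close>
  define b where "b = 3 * e + 3"
  obtain p :: nat where p_props: "prime p" "2 ^ b < p" "p \<le> 2 ^ (2 * b + 4)"
    using exists_prime_between_powers by blast
  have "t \<le> n" using ts by (metis dvd_imp_le dvd_triv_left nat_0_less_mult_iff)
  have "8 * (n + 2) ^ 3 \<le> 8 * (2 ^ e) ^ 3" using e by (intro mult_le_mono2 power_mono) auto
  also have "\<dots> = 2 ^ b" by (simp add: b_def power_add power_mult mult.commute)
  finally have b: "8 * (n + 2) ^ 3 \<le> 2 ^ b" .
  have cube: "(n + 2) ^ 3 = n * n * n + 6 * (n * n) + 12 * n + 8"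
    by (simp add: power3_eq_cube algebra_simps)
  interpret label_protocol n t s p "label_weight n" "label_ok n" "label_count n"
  proof
    show "label_weight n u a v b \<le> n + 2" for u a v b by (simp add: label_weight_def)
    show "label_count n v a \<le> 1" for v a by (simp add: label_count_def)
    have "n * n * (n + 2) = n * n * n + 2 * (n * n)" by (simp add: algebra_simps)
    then show "n * n * (n + 2) < p" using b p_props(2) cube by linarith
    show "n < p" using b p_props(2) cube by linarith
  qed (use ts p_props in auto)
  have cert: "certifies \<l> \<sigma> \<longleftrightarrow> (\<forall>u<n. \<forall>v<n. label_ok n u (\<l> u) v (\<l> v)) \<and>
      (\<Sum>(u, v)\<in>set \<sigma>. label_weight n u (\<l> u) v (\<l> v)) = (\<Sum>v<n. label_count n v (\<l> v))" for \<l> \<sigma>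
    by (rule certifies_def)
  have "\<exists>P. is_scheme_for max_matching_size n P \<and> help_bounded P n (t * t * ((2 * b + 4) * (4 * s))) \<and>
      space_bounded P (2 * e + (2 * b + 4) * (4 * s) + (2 * b + 4) * (2 * s + 5))"
  proof (rule protocol_scheme)
    show "\<exists>\<l>. (\<forall>v<n. \<l> v < p) \<and> certifies \<l> \<sigma>" if "valid_stream n \<sigma>" for \<sigma>
    proof -
      have "(n + 1) ^ 3 \<le> (n + 2) ^ 3" by (intro power_mono) auto
      then have "(n + 1) ^ 3 < p" using b p_props(2) by linarith
      moreover have "simple_on n (set \<sigma>)" using that by (simp add: valid_stream_iff)
      then obtain \<l> where "\<forall>v<n. \<l> v < (n + 1) ^ 3" "certifies \<l> \<sigma>"
        unfolding cert using label_complete[of n "set \<sigma>"] by auto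
      ultimately show ?thesis by (intro exI[of _ \<l>]) (auto intro: less_trans)
    qed
    show "(\<Sum>v<n. label_count n v (\<l> v)) = max_matching_size \<sigma>"
      if "valid_stream n \<sigma>" "certifies \<l> \<sigma>" for \<sigma> \<l>
    proof -
      have "simple_on n (set \<sigma>)" using that(1) by (simp add: valid_stream_iff)
      then show ?thesis using that(2) unfolding cert max_matching_size_eq
        by (elim conjE) (rule label_sound)
    qed
    show "p \<le> 2 ^ (2 * b + 4)" "2 ^ b \<le> p" using p_props by auto
    have "n * t \<le> n * n" using \<open>t \<le> n\<close> by simp
    then show "3 * N \<le> 2 ^ b" unfolding N_eq using b cube by linarith
    have "t * t + 2 \<le> (n + 2) * (n + 2)" using mult_le_mono[OF \<open>t \<le> n\<close> \<open>t \<le> n\<close>] by simp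
    also have "\<dots> \<le> 2 ^ e * 2 ^ e" using e by (intro mult_le_mono) auto
    also have "\<dots> = 2 ^ (2 * e)" by (simp add: mult_2 power_add)
    finally show "t * t + 2 \<le> 2 ^ (2 * e)" .
  qed
  moreover have "2 * b + 4 = 6 * e + 10" by (simp add: b_def)
  ultimately show ?thesis by simp
qed

lemma matching_upper_bound:
  "\<exists>c::real. c > 0 \<and>
     (\<forall>n t s::nat. 0 < t \<and> 0 < s \<and> t * s = n \<longrightarrow>
        (\<exists>P H S. is_scheme_for max_matching_size n P \<and> help_bounded P n H \<and>
            space_bounded P S \<and>
            real H \<le> c * real (n * t) * (log 2 (real n + 2)) ^ nat \<lceil>c\<rceil> \<and>
            real S \<le> c * real s * (log 2 (real n + 2)) ^ nat \<lceil>c\<rceil>))"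
\<comment> \<open>One constant serves as factor and as exponent. The bounds need factors 4 * 32 =
  128 for help and 4 + 11 * 32 = 356 for space with a single logarithm; since the logarithm is at
  least 1, raising it to a higher power is harmless.\<close>
proof (rule exI[of _ 400], intro conjI allI impI)
  fix n t s :: nat
  assume h: "0 < t \<and> 0 < s \<and> t * s = n"
  define lg where "lg = log 2 (real n + 2)"
  define e where "e = nat \<lceil>lg\<rceil>"
  have lg1: "lg \<ge> 1" unfolding lg_def by (subst le_log_iff) auto
  have e1: "1 \<le> real e" "lg \<le> real e" "real e \<le> 2 * lg" using lg1 unfolding e_def by linarith+
  have "real n + 2 = 2 powr lg" by (simp add: lg_def)
  also have "\<dots> \<le> 2 powr real e" using e1 by (intro powr_mono) auto
  also have "\<dots> = real (2 ^ e)" by (simp add: powr_realpow)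
  finally have e2: "n + 2 \<le> 2 ^ e" by linarith
  define q where "q = 6 * e + 10"
  have q: "real q \<le> 32 * lg" using e1 by (simp add: q_def)
  define H where "H = t * t * (q * (4 * s))"
  define S where "S = 2 * e + q * (4 * s) + q * (2 * s + 5)"
  have "\<exists>P. is_scheme_for max_matching_size n P \<and> help_bounded P n H \<and> space_bounded P S"
    unfolding H_def S_def q_def using matching_scheme_exists[OF _ _ _ e2] h by blast
  moreover have pow: "lg \<le> lg ^ 400" using lg1 power_increasing[of 1 400 lg] by simp
  moreover have "real H \<le> 400 * real (n * t) * lg ^ 400"
  proof -
    have "H = 4 * (n * t) * q" using h by (auto simp: H_def algebra_simps)
    then have "real H = 4 * real (n * t) * real q" by simp
    also have "\<dots> \<le> 4 * real (n * t) * (32 * lg)" using q by (intro mult_left_mono) auto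
    also have "\<dots> \<le> 400 * real (n * t) * lg" using lg1 by (simp add: mult_right_mono)
    also have "\<dots> \<le> 400 * real (n * t) * lg ^ 400" using pow by (intro mult_left_mono) auto
    finally show ?thesis .
  qed
  moreover have "real S \<le> 400 * real s * lg ^ 400"
  proof -
    have s: "real s \<ge> 1" using h by simp
    have "S \<le> 2 * e * s + q * (4 * s) + q * (7 * s)" unfolding S_def
      using h by (intro add_mono mult_le_mono2) auto
    also have "\<dots> = (2 * e + 11 * q) * s" by (simp add: algebra_simps)
    finally have "real S \<le> real ((2 * e + 11 * q) * s)" by (simp only: of_nat_le_iff)
    also have "\<dots> = (2 * real e + 11 * real q) * real s" by simp
    also have "\<dots> \<le> (400 * lg) * real s" using e1 q by (intro mult_right_mono) auto
    also have "\<dots> \<le> 400 * real s * lg ^ 400" using mult_left_mono[OF pow, of "400 * real s"] by (simp add: mult.commute mult.left_commute)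
    finally show ?thesis .
  qed
  ultimately show "\<exists>P H S. is_scheme_for max_matching_size n P \<and> help_bounded P n H \<and>
            space_bounded P S \<and>
            real H \<le> 400 * real (n * t) * (log 2 (real n + 2)) ^ nat \<lceil>400::real\<rceil> \<and>
            real S \<le> 400 * real s * (log 2 (real n + 2)) ^ nat \<lceil>400::real\<rceil>"
    unfolding lg_def[symmetric] by auto
qed simp

theorem theorem4p1:
  shows "(\<exists>c::real. c > 0 \<and>
           (\<forall>n t s::nat. 0 < t \<and> 0 < s \<and> t * s = n \<longrightarrow>
              (\<exists>P H S. is_scheme_for max_matching_size n P \<and> help_bounded P n H \<and>
                  space_bounded P S \<and>
                  real H \<le> c * real (n * t) * (log 2 (real n + 2)) ^ nat \<lceil>c\<rceil> \<and>
                  real S \<le> c * real s * (log 2 (real n + 2)) ^ nat \<lceil>c\<rceil>)))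
       \<and> (\<exists>d::real. d > 0 \<and> (\<exists>N. \<forall>n \<ge> N. \<forall>P H S.
              is_scheme_for max_matching_size n P \<and> help_bounded P n H \<and> space_bounded P S
              \<longrightarrow> real ((H + 1) * (S + 1)) \<ge> d * real n ^ 2))"
  using matching_upper_bound matching_lower_bound by (rule conjI)

end
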